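(* Let $L>0$, $a_0>0$, let $H$ be the uniform distribution on $[-L,L]$ and let $\kappa_n>0$ satisfy $\kappa_n\asymp n^{-a_0}$ (i.e. $C_1n^{-a_0}\le\kappa_n\le C_2n^{-a_0}$ for all $n$, for some constants $C_1,C_2>0$). Let $\Pi_{\mathrm{DP}}$ be the Dirichlet process prior $\mathrm{DP}(\kappa_n,H)$ on the mixing distribution. Then there is a constant $C>1$ depending only on the prior distribution such that for every sequence of positive integers $k^\star=k^\star_n$ (growing arbitrarily fast or not), $$\sup_{\nu^\star\in\mathcal M_{k^\star}}\mathsf P^{(n)}_{\nu^\star*\Phi}\big[\Pi_{\mathrm{DP}}(T_n>Ck^\star\,|\,X_{1:n})\big]\to0\quad(n\to\infty),$$ where $T_n$ is the number of clusters.
   Context: $\mathcal M_k$ is the set of distributions $\sum_{j=1}^kw_j\delta_{\theta_j}$ with $w_j\ge0$, $\sum_jw_j=1$, $\theta_j\in[-L,L]$. For $\nu=\sum_jw_j\delta_{\theta_j}$, $\nu*\Phi=\sum_jw_j\mathrm N(\theta_j,1)$. $\mathsf P^{(n)}_G$ denotes probability or expectation when $X_1,\dots,X_n$ are i.i.d. from $G$; $X_{1:n}=(X_1,\dots,X_n)$. Dirichlet process prior: $\tilde\nu\sim\mathrm{DP}(\kappa,H)$ is represented as $\tilde\nu=\sum_{j=1}^\infty w_j\delta_{\theta_j}$ with $w_j=E_j\prod_{h=1}^{j-1}(1-E_h)$, $E_j$ i.i.d. $\mathrm{Beta}(1,\kappa)$ and, independently, $\theta_j$ i.i.d. $H$.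 Latent assignments: given $\tilde\nu$, $Z_1,\dots,Z_n\in\mathbb N$ are i.i.d. with $\Pr(Z_i=j)=p_{w[\tilde\nu]}(j):=w_j$, and $X_i|Z_i\sim\mathrm N(\theta_{Z_i},1)$ independently. With $\phi$ the standard normal density, the joint posterior is $$\Pi_{\mathrm{DP}}(\mathrm d\tilde\nu,Z_{1:n}|X_{1:n})=\frac{\big[\prod_{i=1}^n\phi(X_i-\theta_{Z_i})p_{w[\tilde\nu]}(Z_i)\big]\Pi_{\mathrm{DP}}(\mathrm d\tilde\nu)}{\int\sum_{Z_{1:n}\in\mathbb N^n}\big[\prod_{i=1}^n\phi(X_i-\theta_{Z_i})p_{w[\tilde\nu]}(Z_i)\big]\Pi_{\mathrm{DP}}(\mathrm d\tilde\nu)}.$$ The number of clusters is $T_n=T_n(Z_{1:n}):=|\{j\in\mathbb N:\exists i\in\{1,\dots,n\},\ Z_i=j\}|$. *)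

theory Defs
  imports "HOL-Probability.Probability"
begin

subsection \<open>Finite mixtures of Gaussians\<close>

text \<open>The discrete distribution with mass \<open>w j\<close> at \<open>\<theta> j\<close> for \<open>j < k\<close>, i.e. the sum of the
  \<open>w j\<close>-weighted Dirac masses. The atoms need not be distinct and weights may vanish.\<close>

definition atomic_mixture :: "nat \<Rightarrow> (nat \<Rightarrow> real) \<Rightarrow> (nat \<Rightarrow> real) \<Rightarrow> real measure" where
  "atomic_mixture k w \<theta> = distr (point_measure {..<k} (\<lambda>j. ennreal (w j))) borel \<theta>"

definition mixing_distributions :: "real \<Rightarrow> nat \<Rightarrow> real measure set" where
  "mixing_distributions L k =
     {atomic_mixture k w \<theta> | w \<theta>.
        (\<forall>j<k. 0 \<le> w j) \<and> (\<Sum>j<k. w j) = 1 \<and> (\<forall>j<k. \<theta> j \<in> {-L..L})}"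

definition std_normal_distr :: "real measure" where
  "std_normal_distr = density lborel (\<lambda>x. ennreal (std_normal_density x))"

definition gaussian_mixture :: "real measure \<Rightarrow> real measure" where
  "gaussian_mixture \<nu> = (\<nu> \<star> std_normal_distr)"

definition iid_sample :: "nat \<Rightarrow> real measure \<Rightarrow> (nat \<Rightarrow> real) measure" where
  "iid_sample n G = (\<Pi>\<^sub>M i\<in>{1..n}. G)"


subsection \<open>The Dirichlet process prior\<close>

definition beta_distr :: "real \<Rightarrow> real \<Rightarrow> real measure" where
  "beta_distr a b = density lborel
     (\<lambda>x. ennreal (indicator {0<..<1} x * (x powr (a - 1) * (1 - x) powr (b - 1) / Beta a b)))"

definition stick_breaking :: "(nat \<Rightarrow> real) \<Rightarrow> nat \<Rightarrow> real" where
  "stick_breaking E j = E j * (\<Prod>h<j. 1 - E h)"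

text \<open>The Dirichlet process as the joint law of the weight sequence \<open>w\<close> and the atom sequence
  \<open>\<theta>\<close> of the random measure with mass \<open>w j\<close> at \<open>\<theta> j\<close>. The law is kept on pairs
  \<open>(w, \<theta>)\<close> rather than pushed forward to measures because the latent
  assignments refer to the indices of the atoms. Components are numbered from 0.\<close>

definition dirichlet_process ::
    "real \<Rightarrow> real measure \<Rightarrow> ((nat \<Rightarrow> real) \<times> (nat \<Rightarrow> real)) measure" where
  "dirichlet_process \<kappa> H =
     distr (\<Pi>\<^sub>M j\<in>UNIV. beta_distr 1 \<kappa>) (\<Pi>\<^sub>M j\<in>UNIV. borel) stick_breaking
     \<Otimes>\<^sub>M (\<Pi>\<^sub>M j\<in>UNIV. H)"


subsection \<open>Latent assignments and the joint posterior\<close>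

definition assignments :: "nat \<Rightarrow> (nat \<Rightarrow> nat) set" where
  "assignments n = {1..n} \<rightarrow>\<^sub>E UNIV"

definition num_clusters :: "nat \<Rightarrow> (nat \<Rightarrow> nat) \<Rightarrow> nat" where
  "num_clusters n Z = card {j. \<exists>i\<in>{1..n}. Z i = j}"

definition complete_likelihood ::
    "nat \<Rightarrow> (nat \<Rightarrow> real) \<Rightarrow> ((nat \<Rightarrow> real) \<times> (nat \<Rightarrow> real)) \<Rightarrow> (nat \<Rightarrow> nat) \<Rightarrow> ennreal" where
  "complete_likelihood n X = (\<lambda>(w, \<theta>) Z.
     ennreal (\<Prod>i\<in>{1..n}. std_normal_density (X i - \<theta> (Z i)) * w (Z i)))"

definition evidence ::
    "((nat \<Rightarrow> real) \<times> (nat \<Rightarrow> real)) measure \<Rightarrow> nat \<Rightarrow> (nat \<Rightarrow> real) \<Rightarrow> ennreal" where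
  "evidence prior n X =
     (\<integral>\<^sup>+ \<nu>. (\<integral>\<^sup>+ Z. complete_likelihood n X \<nu> Z \<partial>count_space (assignments n)) \<partial>prior)"

definition posterior ::
    "((nat \<Rightarrow> real) \<times> (nat \<Rightarrow> real)) measure \<Rightarrow> nat \<Rightarrow> (nat \<Rightarrow> real) \<Rightarrow>
     (((nat \<Rightarrow> real) \<times> (nat \<Rightarrow> real)) \<times> (nat \<Rightarrow> nat)) measure" where
  "posterior prior n X =
     density (prior \<Otimes>\<^sub>M count_space (assignments n))
       (\<lambda>(\<nu>, Z). complete_likelihood n X \<nu> Z / evidence prior n X)"

definition posterior_prob_clusters_gt ::
    "((nat \<Rightarrow> real) \<times> (nat \<Rightarrow> real)) measure \<Rightarrow> nat \<Rightarrow> (nat \<Rightarrow> real) \<Rightarrow> real \<Rightarrow> ennreal" where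
  "posterior_prob_clusters_gt prior n X t =
     emeasure (posterior prior n X)
       {(\<nu>, Z) \<in> space (posterior prior n X). t < real (num_clusters n Z)}"

end

theory Submission
  imports Defs "HOL-Real_Asymp.Real_Asymp"
begin

text \<open>Writing \<open>g\<close> for the true mixture density, every label sequence with values in the \<open>k\<close> true
  components contributes to the evidence, and this bounds the evidence from below by
  \<open>(c \<kappa> / n\<^sup>2)\<^sup>k\<close> times \<open>\<Prod>i. exp (- \<bar>X i\<bar> / n) * g (X i)\<close>, for every sample. Dividing by this bound and taking
  expectations under \<open>g\<close> cancels the density, so the expected posterior probability of more than
  \<open>m\<close> clusters is at most \<open>(C n\<^sup>2 / \<kappa>)\<^sup>k\<close> times its prior probability. Comparing the label
  probabilities for concentration \<open>\<kappa> \<le> 1\<close> with those for concentration 1, each cluster after the first costs a factor \<open>\<kappa>\<close>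
  and everything else at most \<open>n (n + 1)\<close>, so the prior probability is at most
  \<open>n (n + 1) \<kappa>\<^sup>m\<close>. As \<open>\<kappa>\<close> is polynomially small in \<open>n\<close>, choosing \<open>m\<close> a large multiple of \<open>k\<close> wins.\<close>

subsection \<open>Moments of the stick proportions\<close>

text \<open>The integrand sees only the coordinates in the finite set \<open>J\<close>, so the
  integral is pushed forward along restriction to \<open>J\<close>, where the finite product formula
  applies. The index set \<open>I\<close> may be infinite, as it is for sticks and atoms.\<close>

lemma nn_integral_PiM_prod:
  assumes "\<And>i. prob_space (M i)" and "finite J" and "J \<subseteq> I"
    and "\<And>i. i \<in> J \<Longrightarrow> f i \<in> borel_measurable (M i)"
  shows "(\<integral>\<^sup>+x. (\<Prod>i\<in>J. f i (x i)) \<partial>PiM I M) = (\<Prod>i\<in>J. \<integral>\<^sup>+x. f i x \<partial>M i)"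
proof -
  interpret product_prob_space M I
    using assms(1)
    by (auto simp: product_prob_space_def product_prob_space_axioms_def product_sigma_finite_def
        intro: prob_space_imp_sigma_finite)
  note assms(4)[measurable]
  have "(\<Prod>i\<in>J. \<integral>\<^sup>+x. f i x \<partial>M i) = (\<integral>\<^sup>+x. (\<Prod>i\<in>J. f i (x i)) \<partial>PiM J M)"
    using assms by (intro product_nn_integral_prod[symmetric]) auto
  also have "\<dots> = (\<integral>\<^sup>+x. (\<Prod>i\<in>J. f i (x i)) \<partial>distr (PiM I M) (PiM J M) (\<lambda>x. restrict x J))"
    using assms by (subst distr_PiM_restrict_finite) auto
  also have "\<dots> = (\<integral>\<^sup>+x. (\<Prod>i\<in>J. f i (restrict x J i)) \<partial>PiM I M)"
    using assms(3) by (subst nn_integral_distr) (auto intro!: measurable_restrict_subset)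
  finally show ?thesis by simp
qed

lemma Beta_1_left: "0 < \<kappa> \<Longrightarrow> Beta 1 \<kappa> = 1 / (\<kappa>::real)"
proof -
  assume "0 < \<kappa>"
  then have "Gamma (\<kappa> + 1) = \<kappa> * Gamma \<kappa>" "Gamma \<kappa> \<noteq> 0"
    using Gamma_plus1[of \<kappa>] Gamma_real_pos[of \<kappa>]
      nonpos_Ints_nonpos[of \<kappa>] by force+
  then show ?thesis by (simp add: Beta_def add.commute)
qed

lemma sets_beta_distr[measurable_cong]: "sets (beta_distr a b) = sets borel"
  by (simp add: beta_distr_def)

text \<open>A beta density times a monomial in \<open>x\<close> and \<open>1 - x\<close> is again an
  unnormalised beta density; the factor \<open>\<kappa>\<close> is
  \<open>1 / Beta 1 \<kappa>\<close>.\<close>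

lemma beta_moment:
  assumes "0 < \<kappa>"
  shows "(\<integral>\<^sup>+x. ennreal (x ^ a * (1 - x) ^ b) \<partial>beta_distr 1 \<kappa>) =
    ennreal (\<kappa> * Beta (real a + 1) (real b + \<kappa>))"
proof -
  let ?g = "\<lambda>t. indicator {0<..<1} t * (\<kappa> * (t powr (real a + 1 - 1) * (1 - t) powr (real b + \<kappa> - 1)))"
  have "((\<lambda>t. t powr (real a + 1 - 1) * (1 - t) powr (real b + \<kappa> - 1)) has_integral
      Beta (real a + 1) (real b + \<kappa>)) {0<..<1}"
    using has_integral_Beta_real[of "real a + 1" "real b + \<kappa>"] assms
    by (simp add: has_integral_Icc_iff_Ioo)
  then have "((\<lambda>t. \<kappa> * (t powr (real a + 1 - 1) * (1 - t) powr (real b + \<kappa> - 1))) has_integral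
      \<kappa> * Beta (real a + 1) (real b + \<kappa>)) {0<..<1}"
    by (rule has_integral_mult_right)
  then have "(?g has_integral \<kappa> * Beta (real a + 1) (real b + \<kappa>)) UNIV"
    by (subst (asm) has_integral_restrict_UNIV[symmetric])
       (simp add: indicator_def of_bool_def if_distrib if_distribR cong: if_cong)
  then have "(\<integral>\<^sup>+t. ennreal (?g t) \<partial>lborel) = ennreal (\<kappa> * Beta (real a + 1) (real b + \<kappa>))"
    using assms by (intro nn_integral_has_integral_lborel) auto
  moreover have "(\<integral>\<^sup>+x. ennreal (x ^ a * (1 - x) ^ b) \<partial>beta_distr 1 \<kappa>) = (\<integral>\<^sup>+t. ennreal (?g t) \<partial>lborel)"
    unfolding beta_distr_def
  proof (subst nn_integral_density; (intro nn_integral_cong)?)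
    fix x :: real
    show "ennreal (indicator {0<..<1} x * (x powr (1 - 1) * (1 - x) powr (\<kappa> - 1) / Beta 1 \<kappa>)) *
        ennreal (x ^ a * (1 - x) ^ b) = ennreal (?g x)"
    proof (cases "x \<in> {0<..<1}")
      case True
      then have "(1 - x) powr (real b + \<kappa> - 1) = (1 - x) powr (\<kappa> - 1) * (1 - x) ^ b"
        by (simp add: powr_add[symmetric] powr_realpow[symmetric] algebra_simps)
      moreover have "x powr (real a) = x ^ a"
        using True by (simp add: powr_realpow)
      ultimately show ?thesis
        using True assms by (simp add: Beta_1_left ennreal_mult'[symmetric] mult_ac)
    qed simp
  qed auto
  ultimately show ?thesis by simp
qed

lemma prob_space_beta_distr: "0 < \<kappa> \<Longrightarrow> prob_space (beta_distr 1 \<kappa>)"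
  using beta_moment[of \<kappa> 0 0] by (intro prob_spaceI) (simp add: Beta_1_left)

lemma AE_beta_distr: "AE x in beta_distr a b. 0 < x \<and> x < 1"
  unfolding beta_distr_def by (subst AE_density) (auto simp: indicator_def)

text \<open>Compares the value of a stick monomial at an arbitrary point \<open>e\<close> with its
  mean. One term of the binomial expansion of \<open>(e + (1 - e)) ^ (a + b)\<close> is at most 1,
  and \<open>Beta (a + 1) (b + 1)\<close> is the reciprocal of \<open>a + b + 1\<close> times that
  binomial coefficient.\<close>

lemma beta_moment_ge:
  fixes \<kappa> e :: real
  assumes "0 < \<kappa>" "\<kappa> \<le> 1" "0 \<le> e" "e \<le> 1" "a + b \<le> n"
  shows "\<kappa> / (real n + 1) * (e ^ a * (1 - e) ^ b) \<le> \<kappa> * Beta (real a + 1) (real b + \<kappa>)"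
proof -
  have "real ((a + b) choose a) * (e ^ a * (1 - e) ^ b) \<le> (\<Sum>i\<le>a + b. real ((a + b) choose i) * e ^ i * (1 - e) ^ (a + b - i))"
    using member_le_sum[of a "{..a + b}" "\<lambda>i. real ((a + b) choose i) * e ^ i * (1 - e) ^ (a + b - i)"] assms
    by (simp add: mult.assoc)
  also have "\<dots> = 1"
    by (simp add: binomial_ring[symmetric])
  finally have 1: "real ((a + b) choose a) * (e ^ a * (1 - e) ^ b) \<le> 1" .
  have 2: "fact a * fact b * real ((a + b) choose a) = fact (a + b)"
    using arg_cong[OF binomial_fact_lemma[of a "a + b"], of real] by simp
  have fact_eq: "fact (a + b + 1) = (real (a + b) + 1) * (fact a * fact b * real ((a + b) choose a))"
    unfolding 2 by (simp add: algebra_simps)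
  have "1 / (real n + 1) * (e ^ a * (1 - e) ^ b) \<le> 1 / (real (a + b) + 1) * (e ^ a * (1 - e) ^ b)"
    using assms by (intro mult_right_mono divide_left_mono) auto
  also have "\<dots> = fact a * fact b / fact (a + b + 1) * (real ((a + b) choose a) * (e ^ a * (1 - e) ^ b))"
    using fact_eq by (simp add: divide_simps)
  also have "\<dots> \<le> fact a * fact b / fact (a + b + 1)"
    using mult_left_mono[OF 1, of "fact a * fact b / fact (a + b + 1)"] by simp
  also have "\<dots> = Beta (real a + 1) (real b + 1)"
    using Gamma_fact[of a, where 'a=real] Gamma_fact[of b, where 'a=real]
      Gamma_fact[of "a + b + 1", where 'a=real]
    by (simp add: Beta_def add_ac)
  \<comment> \<open>\<open>Beta\<close> decreases in its second argument, and
    \<open>\<kappa> \<le> 1\<close>.\<close>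
  also have "\<dots> \<le> Beta (real a + 1) (real b + \<kappa>)"
    using assms by (intro Beta_real_mono) auto
  finally show ?thesis
    using mult_left_mono[of _ _ \<kappa>] assms by fastforce
qed

text \<open>Chosen so that the moment ratios telescope along the sticks: at each stick the argument drops from
  the number of observations at or beyond it to the number beyond it.\<close>

definition gap_potential :: "real \<Rightarrow> nat \<Rightarrow> real" where
  "gap_potential \<kappa> m = (if m = 0 then \<kappa> else real m * (real m + 1))"

lemma gap_potential_pos: "0 < \<kappa> \<Longrightarrow> 0 < gap_potential \<kappa> m"
  by (simp add: gap_potential_def)

lemma Beta_pos: "0 < x \<Longrightarrow> 0 < y \<Longrightarrow> 0 < Beta x (y::real)"
  by (simp add: Beta_def Gamma_real_pos)

text \<open>Raising the first argument of both Beta functions from \<open>a + 1\<close> to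
  \<open>a + 2\<close> multiplies their quotient by
  \<open>(a + b + 2) / (a + b + 1 + \<kappa>)\<close>. Dropping \<open>\<kappa>\<close> from the
  denominator makes the product of these factors telescope.\<close>

lemma Beta_ratio_le:
  fixes \<kappa> :: real
  assumes "0 < \<kappa>"
  shows "0 < a \<Longrightarrow> Beta (real a + 1) (real b + \<kappa>)
    \<le> gap_potential \<kappa> (a + b) / gap_potential \<kappa> b * Beta (real a + 1) (real b + 1)"
proof -
  have step: "Beta (real a + 1) (real b + c) = real a / (real a + real b + c) * Beta (real a) (real b + c)"
    if "0 < a" "0 < c" for a b c
    using that Beta_plus1_left[of "real a" "real b + c"] by (simp add: field_simps nonpos_Ints_def)
  have one: "Beta 1 (real b + c) = 1 / (real b + c)" if "0 < c" for c
    using that by (simp add: Beta_1_left)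
  \<comment> \<open>The telescoped product. For \<open>b = 0\<close> the starting quotient
    \<open>Beta 1 \<kappa> / Beta 1 1\<close> is \<open>1 / \<kappa>\<close>, so there
    \<open>\<kappa>\<close> has to stay.\<close>
  define P where "P a = (if b = 0 then (real a + 1) / \<kappa> else (real a + real b + 1) / real b)" for a
  have "Beta (real a + 1) (real b + \<kappa>) \<le> P a * Beta (real a + 1) (real b + 1)" for a
  proof (induction a)
    case 0
    have "Beta 1 \<kappa> = 1 / \<kappa>" and "Beta 1 (1::real) = 1"
      using assms by (simp_all add: Beta_1_left)
    moreover have "real b / (real b + \<kappa>) \<le> 1"
      using assms by simp
    ultimately show ?case
      using assms by (auto simp: P_def one) (simp add: field_simps)
  next
    case (Suc a)
    have "Beta (real (Suc a) + 1) (real b + \<kappa>) = (real a + 1) / (real a + 1 + real b + \<kappa>) * Beta (real a + 1) (real b + \<kappa>)"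
      using step[of "Suc a" \<kappa> b] assms by (simp add: add_ac)
    also have "\<dots> \<le> (real a + 1) / (real a + 1 + real b) * (P a * Beta (real a + 1) (real b + 1))"
      using assms Suc by (intro mult_mono divide_left_mono) (auto intro!: less_imp_le[OF Beta_pos])
    also have "\<dots> = P (Suc a) * ((real a + 1) / (real a + 1 + real b + 1) * Beta (real a + 1) (real b + 1))"
      using assms by (simp add: P_def divide_simps)
    also have "(real a + 1) / (real a + 1 + real b + 1) * Beta (real a + 1) (real b + 1) =
        Beta (real (Suc a) + 1) (real b + 1)"
      using step[of "Suc a" 1 b] by (simp add: add_ac)
    finally show ?case .
  qed
  moreover assume "0 < a"
  \<comment> \<open>\<open>P a\<close> is weakened to a quotient of one function at
    \<open>a + b\<close> and at \<open>b\<close>, so that it telescopes over the sticks. This uses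
    \<open>1 \<le> a\<close>: for \<open>b = 0\<close> a factor \<open>a\<close> is inserted,
    otherwise \<open>b + 1\<close> is raised to \<open>a + b\<close>.\<close>
  then have "P a \<le> gap_potential \<kappa> (a + b) / gap_potential \<kappa> b"
  proof (cases "b = 0")
    case True
    have "1 * (real a + 1) \<le> real a * (real a + 1)"
      using \<open>0 < a\<close> by (intro mult_right_mono) auto
    then show ?thesis
      using assms \<open>0 < a\<close> True by (simp add: P_def gap_potential_def divide_right_mono)
  next
    case False
    have "(real a + real b + 1) / real b = (real b + 1) * (real a + real b + 1) / (real b * (real b + 1))"
      using False by (simp add: divide_simps)
    also have "\<dots> \<le> (real a + real b) * (real a + real b + 1) / (real b * (real b + 1))"
      using False \<open>0 < a\<close> by (intro divide_right_mono mult_right_mono) auto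
    finally show ?thesis
      using False by (simp add: P_def gap_potential_def)
  qed
  then have "P a * Beta (real a + 1) (real b + 1)
      \<le> gap_potential \<kappa> (a + b) / gap_potential \<kappa> b * Beta (real a + 1) (real b + 1)"
    by (intro mult_right_mono less_imp_le[OF Beta_pos]) auto
  ultimately show ?thesis
    by (meson order_trans)
qed

text \<open>An occupied stick keeps the \<open>\<kappa>\<close> of its normalisation. For an empty
  stick the potentials cancel and \<open>\<kappa>\<close> is absorbed, since
  \<open>\<kappa> / (b + \<kappa>) \<le> 1 / (b + 1)\<close>.\<close>

lemma beta_moment_le:
  fixes \<kappa> :: real
  assumes "0 < \<kappa>" "\<kappa> \<le> 1"
  shows "\<kappa> * Beta (real a + 1) (real b + \<kappa>) \<le>
    (if 0 < a then \<kappa> else 1) * (gap_potential \<kappa> (a + b) / gap_potential \<kappa> b) * Beta (real a + 1) (real b + 1)"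
proof (cases "0 < a")
  case True
  then show ?thesis
    using mult_left_mono[OF Beta_ratio_le[OF assms(1) True, of b], of \<kappa>] assms by (simp add: mult.assoc)
next
  case False
  then have "a = 0" by simp
  moreover have "\<kappa> * real b \<le> real b" using assms by (simp add: mult_left_le_one_le)
  ultimately show ?thesis
    using assms gap_potential_pos[of \<kappa> b] by (auto simp: Beta_1_left field_simps)
qed


subsection \<open>Label probabilities under stick breaking\<close>

definition label_prob :: "real \<Rightarrow> nat \<Rightarrow> (nat \<Rightarrow> nat) \<Rightarrow> ennreal" where
  "label_prob \<kappa> n z =
    (\<integral>\<^sup>+E. ennreal (\<Prod>i\<in>{1..n}. stick_breaking E (z i)) \<partial>(\<Pi>\<^sub>M j\<in>UNIV. beta_distr 1 \<kappa>))"

text \<open>The label \<open>z i\<close> takes the fraction \<open>E (z i)\<close> after passing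
  every earlier stick. Exchanging the two products collects these factors by stick instead of by
  observation.\<close>

lemma stick_breaking_prod:
  assumes "finite I" "\<And>i. i \<in> I \<Longrightarrow> z i < k"
  shows "(\<Prod>i\<in>I. stick_breaking E (z i)) =
    (\<Prod>j<k. E j ^ card {i\<in>I. z i = j} * (1 - E j) ^ card {i\<in>I. j < z i})"
proof -
  have power: "(\<Prod>i\<in>I. if P i then c else 1) = c ^ card {i\<in>I. P i}" for P and c :: real
    using assms(1) by (subst prod.inter_filter[symmetric]) auto
  have "stick_breaking E (z i) = (\<Prod>j<k. (if z i = j then E j else 1) * (if j < z i then 1 - E j else 1))"
    if "i \<in> I" for i
  proof -
    have "{j\<in>{..<k}. j < z i} = {..<z i}"
      using assms(2)[OF that] by auto
    then show ?thesis
      using assms(2)[OF that]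
      by (simp add: stick_breaking_def prod.distrib prod.inter_filter[symmetric])
  qed
  then have "(\<Prod>i\<in>I. stick_breaking E (z i)) =
      (\<Prod>i\<in>I. \<Prod>j<k. (if z i = j then E j else 1) * (if j < z i then 1 - E j else 1))"
    by (rule prod.cong[OF refl])
  also have "\<dots> = (\<Prod>j<k. \<Prod>i\<in>I. (if z i = j then E j else 1) * (if j < z i then 1 - E j else 1))"
    by (rule prod.swap)
  finally show ?thesis
    by (simp add: prod.distrib power)
qed

lemma sum_stick_breaking: "(\<Sum>j<k. stick_breaking E j) = 1 - (\<Prod>h<k. 1 - E h)"
  by (induction k) (simp_all add: stick_breaking_def algebra_simps)

lemma AE_sticks: "0 < \<kappa> \<Longrightarrow> AE E in (\<Pi>\<^sub>M j\<in>UNIV. beta_distr 1 \<kappa>). \<forall>j::nat. 0 < E j \<and> E j < 1"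
  unfolding AE_all_countable
  by (intro allI AE_PiM_component prob_space_beta_distr AE_beta_distr) auto

lemma stick_breaking_nonneg:
  assumes "\<And>j. 0 < E j \<and> E j < 1"
  shows "0 \<le> stick_breaking E j"
  unfolding stick_breaking_def using assms
  by (intro mult_nonneg_nonneg prod_nonneg) (auto simp: less_imp_le)

lemma measurable_stick_breaking_component[measurable]:
  "(\<lambda>E. stick_breaking E j) \<in> borel_measurable (\<Pi>\<^sub>M j\<in>UNIV. beta_distr a b)"
  unfolding stick_breaking_def by measurable

text \<open>The integrand is a product over independent sticks, so each factor integrates to a beta
  moment.\<close>

lemma label_prob_eq:
  assumes "0 < \<kappa>" "z \<in> {1..n} \<rightarrow> {..<k}"
  shows "label_prob \<kappa> n z = ennreal (\<Prod>j<k. \<kappa> *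
    Beta (real (card {i\<in>{1..n}. z i = j}) + 1) (real (card {i\<in>{1..n}. j < z i}) + \<kappa>))"
proof -
  let ?a = "\<lambda>j. card {i\<in>{1..n}. z i = j}" and ?b = "\<lambda>j. card {i\<in>{1..n}. j < z i}"
  have "label_prob \<kappa> n z =
      (\<integral>\<^sup>+E. (\<Prod>j<k. ennreal (E j ^ ?a j * (1 - E j) ^ ?b j)) \<partial>(\<Pi>\<^sub>M j\<in>UNIV. beta_distr 1 \<kappa>))"
    unfolding label_prob_def
  \<comment> \<open>Almost surely every proportion lies strictly between 0 and 1; the factors are
    then nonnegative and \<open>ennreal\<close> distributes over the product.\<close>
  proof (rule nn_integral_cong_AE, rule AE_mp[OF AE_sticks[OF assms(1)]], rule AE_I2, rule impI)
    fix E :: "nat \<Rightarrow> real" assume E: "\<forall>j. 0 < E j \<and> E j < 1"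
    have eq: "(\<Prod>i\<in>{1..n}. stick_breaking E (z i)) = (\<Prod>j<k. E j ^ ?a j * (1 - E j) ^ ?b j)"
      using assms(2) by (intro stick_breaking_prod) auto
    show "ennreal (\<Prod>i\<in>{1..n}. stick_breaking E (z i)) =
        (\<Prod>j<k. ennreal (E j ^ ?a j * (1 - E j) ^ ?b j))"
      unfolding eq using E
      by (intro prod_ennreal[symmetric] mult_nonneg_nonneg zero_le_power) (auto intro: less_imp_le)
  qed
  also have "\<dots> = (\<Prod>j<k. \<integral>\<^sup>+x. ennreal (x ^ ?a j * (1 - x) ^ ?b j) \<partial>beta_distr 1 \<kappa>)"
    using assms(1) by (intro nn_integral_PiM_prod prob_space_beta_distr) auto
  also have "\<dots> = (\<Prod>j<k. ennreal (\<kappa> * Beta (real (?a j) + 1) (real (?b j) + \<kappa>)))"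
    using assms(1) by (simp add: beta_moment)
  also have "\<dots> = ennreal (\<Prod>j<k. \<kappa> * Beta (real (?a j) + 1) (real (?b j) + \<kappa>))"
    using assms(1) by (intro prod_ennreal mult_nonneg_nonneg less_imp_le[OF Beta_pos]) auto
  finally show ?thesis .
qed

text \<open>Any probability vector \<open>w\<close> is the stick-breaking image of \<open>e j = w j / (w j + w (j+1) + \<dots>)\<close>,
  division by zero being harmless because then all remaining weights vanish.\<close>

lemma label_prob_ge:
  assumes \<kappa>: "0 < \<kappa>" "\<kappa> \<le> 1"
    and z: "z \<in> {1..n} \<rightarrow> {..<k}"
    and w: "\<And>j. j < k \<Longrightarrow> 0 \<le> w j" "(\<Sum>j<k. w j) = 1"
  shows "ennreal ((\<kappa> / (real n + 1)) ^ k * (\<Prod>i\<in>{1..n}. w (z i))) \<le> label_prob \<kappa> n z"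
proof -
  let ?a = "\<lambda>j. card {i\<in>{1..n}. z i = j}" and ?b = "\<lambda>j. card {i\<in>{1..n}. j < z i}"
  define r where "r j = (\<Sum>h\<in>{j..<k}. w h)" for j
  define e where "e j = w j / r j" for j
  have r_Suc: "r j = w j + r (Suc j)" if "j < k" for j
    unfolding r_def using that by (simp add: sum.atLeast_Suc_lessThan)
  have r_nonneg: "0 \<le> r j" for j
    unfolding r_def using w(1) by (intro sum_nonneg) auto
  have e: "0 \<le> e j" "e j \<le> 1" "w j = e j * r j" "r (Suc j) = (1 - e j) * r j" if "j < k" for j
  proof -
    have "r j = 0 \<Longrightarrow> w j = 0"
      using r_Suc[OF that] r_nonneg[of "Suc j"] w(1)[OF that] by linarith
    then show "w j = e j * r j"
      by (simp add: e_def)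
    then show "r (Suc j) = (1 - e j) * r j"
      using r_Suc[OF that] by (simp add: algebra_simps)
    show "0 \<le> e j" "e j \<le> 1"
      using r_Suc[OF that] r_nonneg[of "Suc j"] r_nonneg[of j] w(1)[OF that]
      by (auto simp: e_def divide_le_eq_1)
  qed
  have r_prod: "j \<le> k \<Longrightarrow> r j = (\<Prod>h<j. 1 - e h)" for j
  proof (induction j)
    case 0
    then show ?case using w(2) by (simp add: r_def lessThan_atLeast0)
  qed (simp add: e(4))
  have w_eq: "w j = stick_breaking e j" if "j < k" for j
    using e(3)[OF that] r_prod[of j] that by (simp add: stick_breaking_def)
  \<comment> \<open>The product of weights is the stick monomial of \<open>z\<close> evaluated at
    the point \<open>e\<close>, and \<open>label_prob\<close> is the mean of the same monomial, so
    the two can be compared stick by stick.\<close>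
  have "(\<Prod>i\<in>{1..n}. w (z i)) = (\<Prod>j<k. e j ^ ?a j * (1 - e j) ^ ?b j)"
    using z by (subst stick_breaking_prod[symmetric]) (auto intro!: prod.cong w_eq simp: Pi_iff)
  then have "(\<kappa> / (real n + 1)) ^ k * (\<Prod>i\<in>{1..n}. w (z i)) =
      (\<Prod>j<k. \<kappa> / (real n + 1) * (e j ^ ?a j * (1 - e j) ^ ?b j))"
    by (simp add: prod.distrib prod_dividef power_divide)
  also have "\<dots> \<le> (\<Prod>j<k. \<kappa> * Beta (real (?a j) + 1) (real (?b j) + \<kappa>))"
  proof (intro prod_mono conjI beta_moment_ge)
    fix j assume "j \<in> {..<k}"
    have "?a j + ?b j = card ({i\<in>{1..n}. z i = j} \<union> {i\<in>{1..n}. j < z i})"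
      by (subst card_Un_disjoint) auto
    also have "\<dots> \<le> card {1..n}"
      by (intro card_mono) auto
    finally show "?a j + ?b j \<le> n" by simp
  qed (use e \<kappa> in auto)
  finally show ?thesis
    unfolding label_prob_eq[OF \<kappa>(1) z] by (rule ennreal_leI)
qed

text \<open>Each stick is compared with its counterpart at concentration 1. Occupied sticks
  contribute \<open>\<kappa>\<close> each, and the potentials telescope as the number of remaining
  observations falls from \<open>n\<close> to 0.\<close>

lemma label_prob_le:
  assumes \<kappa>: "0 < \<kappa>" "\<kappa> \<le> 1" and n: "0 < n"
  shows "label_prob \<kappa> n z \<le>
    ennreal (\<kappa> ^ (num_clusters n z - 1) * (real n * (real n + 1))) * label_prob 1 n z"
proof -
  let ?a = "\<lambda>j. card {i\<in>{1..n}. z i = j}" and ?b = "\<lambda>j. card {i\<in>{1..n}. j < z i}"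
  define c where "c j = card {i\<in>{1..n}. j \<le> z i}" for j
  \<comment> \<open>One past the largest label, so that no observation is left at stick
    \<open>k\<close>.\<close>
  define k where "k = Suc (Max (z ` {1..n}))"
  have z: "z \<in> {1..n} \<rightarrow> {..<k}"
    by (auto simp: k_def less_Suc_eq_le)
  have ab: "?a j + ?b j = c j" for j
    unfolding c_def by (subst card_Un_disjoint[symmetric]) (auto intro!: arg_cong[of _ _ card])
  have b: "?b j = c (Suc j)" for j
    by (simp add: c_def Suc_le_eq)
  have "{i\<in>{1..n}. 0 \<le> z i} = {1..n}"
    by auto
  then have c0: "c 0 = n"
    by (simp only: c_def card_atLeastAtMost)
  have "{i\<in>{1..n}. k \<le> z i} = {}"
    using z by (auto simp: not_le[symmetric])
  then have ck: "c k = 0"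
    by (simp only: c_def card.empty)
  have T: "num_clusters n z = card {j\<in>{..<k}. 0 < ?a j}"
    unfolding num_clusters_def
  proof (intro arg_cong[of _ _ card] set_eqI)
    fix j
    have "0 < ?a j \<longleftrightarrow> (\<exists>i\<in>{1..n}. z i = j)"
      by (subst card_gt_0_iff) auto
    then show "j \<in> {j. \<exists>i\<in>{1..n}. z i = j} \<longleftrightarrow> j \<in> {j\<in>{..<k}. 0 < ?a j}"
      using z by blast
  qed
  have "num_clusters n z \<noteq> 0"
    using n unfolding num_clusters_def by (subst card_eq_0_iff) force
  \<comment> \<open>One factor \<open>\<kappa>\<close> is set aside to cancel the value
    \<open>gap_potential \<kappa> 0 = \<kappa>\<close> in the denominator of the telescoped product.
    This is why the first cluster is free.\<close>
  then have T_Suc: "\<kappa> ^ num_clusters n z = \<kappa> * \<kappa> ^ (num_clusters n z - 1)"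
    by (simp flip: power_Suc)
  have "(\<Prod>j<k. \<kappa> * Beta (real (?a j) + 1) (real (?b j) + \<kappa>)) \<le>
      (\<Prod>j<k. (if 0 < ?a j then \<kappa> else 1) * (gap_potential \<kappa> (?a j + ?b j) / gap_potential \<kappa> (?b j)) *
        Beta (real (?a j) + 1) (real (?b j) + 1))"
    using \<kappa> by (intro prod_mono conjI beta_moment_le mult_nonneg_nonneg less_imp_le[OF Beta_pos]) auto
  also have "\<dots> = (\<Prod>j<k. if 0 < ?a j then \<kappa> else 1) *
      (\<Prod>j<k. gap_potential \<kappa> (c j) / gap_potential \<kappa> (c (Suc j))) *
      (\<Prod>j<k. Beta (real (?a j) + 1) (real (?b j) + 1))"
    unfolding ab by (simp only: b prod.distrib)
  also have "(\<Prod>j<k. if 0 < ?a j then \<kappa> else 1) = \<kappa> ^ num_clusters n z"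
    unfolding T by (subst prod.inter_filter[symmetric]) auto
  also have "(\<Prod>j<k. gap_potential \<kappa> (c j) / gap_potential \<kappa> (c (Suc j))) = real n * (real n + 1) / \<kappa>"
    using prod_lessThan_telescope'[of k "\<lambda>j. gap_potential \<kappa> (c j)"] gap_potential_pos[OF \<kappa>(1)] n
    by (simp add: c0 ck less_imp_neq[symmetric]) (simp add: gap_potential_def)
  finally have "(\<Prod>j<k. \<kappa> * Beta (real (?a j) + 1) (real (?b j) + \<kappa>)) \<le>
      \<kappa> ^ (num_clusters n z - 1) * (real n * (real n + 1)) *
      (\<Prod>j<k. Beta (real (?a j) + 1) (real (?b j) + 1))"
    using \<kappa> by (simp add: T_Suc mult_ac)
  moreover have "label_prob 1 n z = ennreal (\<Prod>j<k. Beta (real (?a j) + 1) (real (?b j) + 1))"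
    using label_prob_eq[OF zero_less_one z] by simp
  moreover have "0 \<le> (\<Prod>j<k. Beta (real (?a j) + 1) (real (?b j) + 1))"
    by (intro prod_nonneg less_imp_le[OF Beta_pos] ballI) auto
  ultimately show ?thesis
    unfolding label_prob_eq[OF \<kappa>(1) z] using \<kappa>
    by (simp only: ennreal_mult[symmetric] mult_nonneg_nonneg of_nat_0_le_iff zero_le_power
        less_imp_le add_nonneg_nonneg zero_le_one) (rule ennreal_leI)
qed

text \<open>Given the sticks, the sequences with labels below \<open>k\<close> have total
  probability \<open>(1 - (\<Prod>h<k. 1 - E h)) ^ n\<close>, which is at most 1. Every label
  sequence is bounded on \<open>{1..n}\<close>, so letting \<open>k\<close> grow reaches the whole
  sum by monotone convergence.\<close>

lemma nn_integral_label_prob_le_1: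
  assumes "0 < \<kappa>"
  shows "(\<integral>\<^sup>+z. label_prob \<kappa> n z \<partial>count_space (assignments n)) \<le> 1"
proof -
  let ?A = "\<lambda>k. {1..n} \<rightarrow>\<^sub>E {..<k::nat}"
  have mono: "incseq (\<lambda>k z. label_prob \<kappa> n z * indicator (?A k) z)"
  proof (intro monoI le_funI mult_left_mono)
    fix k l :: nat and z assume "k \<le> l"
    then have "?A k \<subseteq> ?A l"
      by (intro PiE_mono) auto
    then show "indicator (?A k) z \<le> (indicator (?A l) z :: ennreal)"
      by (auto simp: indicator_def)
  qed simp
  have "(SUP k. label_prob \<kappa> n z * indicator (?A k) z) = label_prob \<kappa> n z" if "z \<in> assignments n" for z
  proof (rule antisym)
    let ?k = "Suc (Max (z ` {1..n}))"
    have "z \<in> ?A ?k"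
      using that by (auto simp: assignments_def PiE_iff less_Suc_eq_le)
    then show "label_prob \<kappa> n z \<le> (SUP k. label_prob \<kappa> n z * indicator (?A k) z)"
      by (intro SUP_upper2[of ?k]) auto
  qed (auto intro!: SUP_least simp: indicator_def)
  then have "(\<integral>\<^sup>+z. label_prob \<kappa> n z \<partial>count_space (assignments n)) =
      (\<integral>\<^sup>+z. (SUP k. label_prob \<kappa> n z * indicator (?A k) z) \<partial>count_space (assignments n))"
    by (intro nn_integral_cong) simp
  also have "\<dots> = (SUP k. \<integral>\<^sup>+z. label_prob \<kappa> n z * indicator (?A k) z \<partial>count_space (assignments n))"
    using mono by (intro nn_integral_monotone_convergence_SUP) auto
  also have "\<dots> \<le> 1"
  proof (rule SUP_least)
    fix k
    have "(\<integral>\<^sup>+z. label_prob \<kappa> n z * indicator (?A k) z \<partial>count_space (assignments n)) =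
        (\<Sum>z\<in>?A k. label_prob \<kappa> n z)"
      by (subst nn_integral_count_space'[of "?A k"])
         (auto intro!: finite_PiE simp: assignments_def PiE_iff)
    also have "\<dots> = (\<integral>\<^sup>+E. (\<Sum>z\<in>?A k. ennreal (\<Prod>i\<in>{1..n}. stick_breaking E (z i)))
        \<partial>(\<Pi>\<^sub>M j\<in>UNIV. beta_distr 1 \<kappa>))"
      unfolding label_prob_def by (subst nn_integral_sum) auto
    also have "\<dots> \<le> (\<integral>\<^sup>+E. 1 \<partial>(\<Pi>\<^sub>M j\<in>(UNIV::nat set). beta_distr 1 \<kappa>))"
    proof (intro nn_integral_mono_AE, use AE_sticks[OF assms] in \<open>rule AE_mp\<close>, intro AE_I2 impI)
      fix E :: "nat \<Rightarrow> real" assume E: "\<forall>j. 0 < E j \<and> E j < 1"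
      have "(\<Sum>z\<in>?A k. ennreal (\<Prod>i\<in>{1..n}. stick_breaking E (z i))) =
          ennreal (\<Sum>z\<in>?A k. \<Prod>i\<in>{1..n}. stick_breaking E (z i))"
        using E by (intro sum_ennreal prod_nonneg) (auto intro: stick_breaking_nonneg)
      also have "\<dots> \<le> ennreal 1"
      proof (rule ennreal_leI)
        have "(\<Sum>z\<in>?A k. \<Prod>i\<in>{1..n}. stick_breaking E (z i)) = (\<Sum>j<k. stick_breaking E j) ^ n"
          by (subst prod_sum_PiE[symmetric]) auto
        also have "\<dots> \<le> 1"
        using E by (intro power_le_one sum_nonneg stick_breaking_nonneg)
          (auto simp: sum_stick_breaking intro!: prod_nonneg intro: less_imp_le)
        finally show "(\<Sum>z\<in>?A k. \<Prod>i\<in>{1..n}. stick_breaking E (z i)) \<le> 1" .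
      qed
      finally show "(\<Sum>z\<in>?A k. ennreal (\<Prod>i\<in>{1..n}. stick_breaking E (z i))) \<le> 1"
        by simp
    qed
    also have "\<dots> = 1"
      using assms by (simp add: prob_space.emeasure_space_1 prob_space_PiM prob_space_beta_distr)
    finally show "(\<integral>\<^sup>+z. label_prob \<kappa> n z * indicator (?A k) z \<partial>count_space (assignments n)) \<le> 1" .
  qed
  finally show ?thesis .
qed

text \<open>A change of measure: more than \<open>m\<close> clusters means at least \<open>m\<close>
  factors \<open>\<kappa>\<close> relative to the law at concentration 1, and that law has total
  mass at most 1.\<close>

lemma label_prob_clusters_gt:
  assumes \<kappa>: "0 < \<kappa>" "\<kappa> \<le> 1" and n: "0 < n"
  shows "(\<integral>\<^sup>+z. indicator {z. m < num_clusters n z} z * label_prob \<kappa> n z \<partial>count_space (assignments n))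
    \<le> ennreal (\<kappa> ^ m * (real n * (real n + 1)))"
proof -
  have "(\<integral>\<^sup>+z. indicator {z. m < num_clusters n z} z * label_prob \<kappa> n z \<partial>count_space (assignments n))
      \<le> (\<integral>\<^sup>+z. ennreal (\<kappa> ^ m * (real n * (real n + 1))) * label_prob 1 n z \<partial>count_space (assignments n))"
  proof (intro nn_integral_mono)
    fix z
    show "indicator {z. m < num_clusters n z} z * label_prob \<kappa> n z
        \<le> ennreal (\<kappa> ^ m * (real n * (real n + 1))) * label_prob 1 n z"
    proof (cases "m < num_clusters n z")
      case True
      then have "\<kappa> ^ (num_clusters n z - 1) \<le> \<kappa> ^ m"
        using \<kappa> by (intro power_decreasing) auto
      then have "ennreal (\<kappa> ^ (num_clusters n z - 1) * (real n * (real n + 1))) * label_prob 1 n z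
          \<le> ennreal (\<kappa> ^ m * (real n * (real n + 1))) * label_prob 1 n z"
        by (intro mult_right_mono ennreal_leI) auto
      then show ?thesis
        using True label_prob_le[OF \<kappa> n, of z] by (auto intro: order_trans)
    qed simp
  qed
  also have "\<dots> = ennreal (\<kappa> ^ m * (real n * (real n + 1))) * (\<integral>\<^sup>+z. label_prob 1 n z \<partial>count_space (assignments n))"
    by (rule nn_integral_cmult) simp
  also have "\<dots> \<le> ennreal (\<kappa> ^ m * (real n * (real n + 1))) * 1"
    by (intro mult_left_mono nn_integral_label_prob_le_1) auto
  finally show ?thesis by simp
qed


subsection \<open>Gaussian mixtures and uniform atoms\<close>

definition mixture_density :: "nat \<Rightarrow> (nat \<Rightarrow> real) \<Rightarrow> (nat \<Rightarrow> real) \<Rightarrow> real \<Rightarrow> real" where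
  "mixture_density k w s x = (\<Sum>j<k. w j * std_normal_density (x - s j))"

lemma borel_measurable_mixture_density[measurable]: "mixture_density k w s \<in> borel_measurable borel"
  unfolding mixture_density_def[abs_def] by measurable

lemma mixture_density_pos:
  assumes "\<And>j. j < k \<Longrightarrow> 0 \<le> w j" "(\<Sum>j<k. w j) = 1"
  shows "0 < mixture_density k w s x"
proof -
  obtain j where j: "j < k" "w j \<noteq> 0"
    using assms(2) by (metis lessThan_iff sum.neutral zero_neq_one)
  then have "0 < w j * std_normal_density (x - s j)"
    using assms(1)[of j] by (simp add: normal_density_pos)
  also have "\<dots> \<le> mixture_density k w s x"
    unfolding mixture_density_def using j assms(1)
    by (intro member_le_sum mult_nonneg_nonneg) auto
  finally show ?thesis .
qed

lemma sets_gaussian_mixture[measurable_cong]: "sets (gaussian_mixture \<nu>) = sets borel"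
  by (simp add: gaussian_mixture_def)

lemma nn_integral_std_normal_density_shift:
  "(\<integral>\<^sup>+x. ennreal (std_normal_density (x - t)) \<partial>lborel) = 1"
proof -
  have "(\<integral>\<^sup>+x. ennreal (std_normal_density (x - t)) \<partial>lborel) =
      (\<integral>\<^sup>+x. ennreal (std_normal_density x) \<partial>lborel)"
    by (subst nn_integral_real_affine[where c=1 and t=t]) auto
  also have "\<dots> = emeasure (density lborel (\<lambda>x. ennreal (std_normal_density x))) UNIV"
    by (subst emeasure_density) auto
  also have "\<dots> = 1"
    using prob_space.emeasure_space_1[OF prob_space_normal_density[of 1 0]] by simp
  finally show ?thesis .
qed

lemma prob_space_std_normal_distr: "prob_space std_normal_distr"
  unfolding std_normal_distr_def by (rule prob_space_normal_density) simp

text \<open>Convolving with atoms averages translates of the normal law; the substitution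
  \<open>x = s j + y\<close> moves each translation into the density.\<close>

lemma nn_integral_gaussian_mixture:
  assumes w: "\<And>j. j < k \<Longrightarrow> 0 \<le> w j" "(\<Sum>j<k. w j) = 1"
    and f[measurable]: "f \<in> borel_measurable borel"
  shows "(\<integral>\<^sup>+x. f x \<partial>gaussian_mixture (atomic_mixture k w s)) =
    (\<integral>\<^sup>+x. ennreal (mixture_density k w s x) * f x \<partial>lborel)"
proof -
  have s: "s \<in> point_measure {..<k} (\<lambda>j. ennreal (w j)) \<rightarrow>\<^sub>M borel"
    by (auto simp: measurable_def sets_point_measure space_point_measure)
  have fin: "finite_measure (atomic_mixture k w s)"
  proof (rule finite_measureI)
    have "emeasure (atomic_mixture k w s) (space (atomic_mixture k w s)) = (\<Sum>j<k. ennreal (w j))"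
      unfolding atomic_mixture_def using s
      by (subst emeasure_distr) (auto simp: space_point_measure emeasure_point_measure_finite)
    then show "emeasure (atomic_mixture k w s) (space (atomic_mixture k w s)) \<noteq> \<infinity>"
      by simp
  qed
  interpret N: prob_space std_normal_distr
    by (rule prob_space_std_normal_distr)
  have [measurable_cong]: "sets std_normal_distr = sets borel"
    by (simp add: std_normal_distr_def)
  have "(\<integral>\<^sup>+x. f x \<partial>gaussian_mixture (atomic_mixture k w s)) =
      (\<integral>\<^sup>+x. \<integral>\<^sup>+y. f (x + y) \<partial>std_normal_distr \<partial>atomic_mixture k w s)"
    unfolding gaussian_mixture_def
    using fin N.finite_measure_axioms by (rule nn_integral_convolution)
      (auto simp: std_normal_distr_def atomic_mixture_def)
  also have "\<dots> = (\<Sum>j<k. ennreal (w j) * (\<integral>\<^sup>+y. f (s j + y) \<partial>std_normal_distr))"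
    unfolding atomic_mixture_def
    by (subst nn_integral_distr[OF s])
       (auto simp: nn_integral_point_measure_finite intro!: N.borel_measurable_nn_integral)
  also have "\<dots> = (\<Sum>j<k. \<integral>\<^sup>+x. ennreal (w j) * ennreal (std_normal_density (x - s j)) * f x \<partial>lborel)"
  proof (rule sum.cong[OF refl])
    fix j
    have "(\<integral>\<^sup>+y. f (s j + y) \<partial>std_normal_distr) =
        (\<integral>\<^sup>+y. ennreal (std_normal_density y) * f (s j + y) \<partial>lborel)"
      unfolding std_normal_distr_def by (subst nn_integral_density) auto
    also have "\<dots> = (\<integral>\<^sup>+x. ennreal (std_normal_density (x - s j)) * f x \<partial>lborel)"
      by (subst (2) nn_integral_real_affine[where c=1 and t="s j"]) auto
    finally show "ennreal (w j) * (\<integral>\<^sup>+y. f (s j + y) \<partial>std_normal_distr) =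
        (\<integral>\<^sup>+x. ennreal (w j) * ennreal (std_normal_density (x - s j)) * f x \<partial>lborel)"
      by (simp add: nn_integral_cmult[symmetric] mult.assoc)
  qed
  also have "\<dots> = (\<integral>\<^sup>+x. (\<Sum>j<k. ennreal (w j) * ennreal (std_normal_density (x - s j)) * f x) \<partial>lborel)"
    by (rule nn_integral_sum[symmetric]) auto
  also have "\<dots> = (\<integral>\<^sup>+x. ennreal (mixture_density k w s x) * f x \<partial>lborel)"
    using w(1) by (intro nn_integral_cong)
      (auto simp: mixture_density_def sum_distrib_right[symmetric] ennreal_mult[symmetric]
        intro!: arg_cong2[of _ _ _ _ "(*)"] sum_ennreal)
  finally show ?thesis .
qed

lemma prob_space_gaussian_mixture:
  assumes "\<And>j. j < k \<Longrightarrow> 0 \<le> w j" "(\<Sum>j<k. w j) = 1"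
  shows "prob_space (gaussian_mixture (atomic_mixture k w s))"
proof (rule prob_spaceI)
  have "emeasure (gaussian_mixture (atomic_mixture k w s)) (space (gaussian_mixture (atomic_mixture k w s))) =
      (\<integral>\<^sup>+x. 1 \<partial>gaussian_mixture (atomic_mixture k w s))"
    by simp
  also have "\<dots> = (\<integral>\<^sup>+x. (\<Sum>j<k. ennreal (w j) * ennreal (std_normal_density (x - s j))) \<partial>lborel)"
    using assms by (subst nn_integral_gaussian_mixture)
      (auto simp: mixture_density_def ennreal_mult[symmetric] intro!: sum_ennreal[symmetric] nn_integral_cong)
  also have "\<dots> = (\<Sum>j<k. ennreal (w j))"
    by (simp add: nn_integral_sum nn_integral_cmult nn_integral_std_normal_density_shift)
  also have "\<dots> = 1"
    using assms by (subst sum_ennreal) auto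
  finally show "emeasure (gaussian_mixture (atomic_mixture k w s))
      (space (gaussian_mixture (atomic_mixture k w s))) = 1" .
qed

text \<open>Completing the square: exponential tilting by \<open>c\<close> moves the mean from
  \<open>t\<close> to \<open>t + c\<close>.\<close>

lemma std_normal_density_tilt:
  "std_normal_density (x - t) * exp (c * x) = exp (c * t + c\<^sup>2 / 2) * std_normal_density (x - (t + c))"
proof -
  have "- (x - t)\<^sup>2 / 2 + c * x = (c * t + c\<^sup>2 / 2) + - (x - (t + c))\<^sup>2 / 2"
    by (simp add: power2_eq_square field_simps)
  then have "exp (- (x - t)\<^sup>2 / 2) * exp (c * x) = exp (c * t + c\<^sup>2 / 2) * exp (- (x - (t + c))\<^sup>2 / 2)"
    by (simp only: exp_add[symmetric])
  then show ?thesis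
    by (simp add: std_normal_density_def)
qed

text \<open>The bound is 1 plus a term linear in \<open>\<delta>\<close>, so its \<open>n\<close>-th
  power stays bounded when \<open>\<delta> = 1 / n\<close>. The exponential is reduced to tilts by 1
  and -1, which are explicit.\<close>

lemma nn_integral_normal_exp_abs:
  assumes "\<bar>t\<bar> \<le> L" "0 \<le> \<delta>" "\<delta> \<le> 1"
  shows "(\<integral>\<^sup>+x. ennreal (std_normal_density (x - t) * exp (\<delta> * \<bar>x\<bar>)) \<partial>lborel)
    \<le> ennreal (1 + \<delta> * (2 * exp (L + 1 / 2)))"
proof -
  let ?\<phi> = "\<lambda>x. ennreal (std_normal_density x)" and ?c = "ennreal (\<delta> * exp (L + 1 / 2))"
  have "(\<integral>\<^sup>+x. ennreal (std_normal_density (x - t) * exp (\<delta> * \<bar>x\<bar>)) \<partial>lborel) \<le>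
      (\<integral>\<^sup>+x. ?\<phi> (x - t) + (?c * ?\<phi> (x - (t + 1)) + ?c * ?\<phi> (x - (t + (-1)))) \<partial>lborel)"
  proof (rule nn_integral_mono)
    fix x :: real
    \<comment> \<open>Convexity of \<open>exp\<close> between \<open>\<bar>x\<bar>\<close> and 0,
      with weights \<open>\<delta>\<close> and \<open>1 - \<delta>\<close>.\<close>
    have "exp (\<delta> * \<bar>x\<bar> + (1 - \<delta>) * 0) \<le> \<delta> * exp \<bar>x\<bar> + (1 - \<delta>) * exp 0"
      using convex_onD[OF convex_on_exp[of 1], of "1 - \<delta>" "\<bar>x\<bar>" 0] assms(2,3) by simp
    also have "\<dots> \<le> 1 + \<delta> * (exp (1 * x) + exp (-1 * x))"
      using assms(2) by (cases "0 \<le> x") (auto simp: algebra_simps intro: add_mono mult_left_mono)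
    finally have "std_normal_density (x - t) * exp (\<delta> * \<bar>x\<bar>) \<le>
        std_normal_density (x - t) * (1 + \<delta> * (exp (1 * x) + exp (-1 * x)))"
      by (intro mult_left_mono) auto
    also have "\<dots> = std_normal_density (x - t) +
        \<delta> * (std_normal_density (x - t) * exp (1 * x) + std_normal_density (x - t) * exp (-1 * x))"
      by (simp only: algebra_simps)
    also have "\<dots> = std_normal_density (x - t) +
        \<delta> * (exp (1 * t + 1\<^sup>2 / 2) * std_normal_density (x - (t + 1)) +
          exp (-1 * t + (-1)\<^sup>2 / 2) * std_normal_density (x - (t + (-1))))"
      by (simp only: std_normal_density_tilt)
    also have "\<dots> \<le> std_normal_density (x - t) +
        \<delta> * (exp (L + 1 / 2) * std_normal_density (x - (t + 1)) +
          exp (L + 1 / 2) * std_normal_density (x - (t + (-1))))"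
      using assms by (intro add_left_mono mult_left_mono add_mono mult_right_mono) auto
    finally show "ennreal (std_normal_density (x - t) * exp (\<delta> * \<bar>x\<bar>)) \<le>
        ?\<phi> (x - t) + (?c * ?\<phi> (x - (t + 1)) + ?c * ?\<phi> (x - (t + (-1))))"
      using assms(2) by (simp add: ennreal_mult[symmetric] ennreal_plus[symmetric] algebra_simps
          ennreal_leI del: ennreal_plus)
  qed
  also have "\<dots> = 1 + (?c + ?c)"
    by (simp add: nn_integral_add nn_integral_cmult nn_integral_std_normal_density_shift
        del: diff_diff_eq2 diff_add_eq_diff_diff_swap)
  also have "\<dots> = ennreal (1 + \<delta> * (2 * exp (L + 1 / 2)))"
    using assms(2) by (simp add: ennreal_plus[symmetric] algebra_simps flip: ennreal_1 del: ennreal_plus)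
  finally show ?thesis .
qed

text \<open>In the difference of the two exponents the squares of \<open>x\<close> cancel; what
  remains is linear in \<open>x\<close> with slope \<open>t - s\<close>, plus a constant of size at
  most \<open>\<delta> * L\<close>.\<close>

lemma std_normal_density_shift_ge:
  assumes "\<bar>t - s\<bar> \<le> \<delta>" "\<bar>t\<bar> \<le> L" "\<bar>s\<bar> \<le> L"
  shows "exp (- \<delta> * L) * (exp (- \<delta> * \<bar>x\<bar>) * std_normal_density (x - s)) \<le> std_normal_density (x - t)"
proof -
  have "\<bar>(t - s) * x\<bar> \<le> \<delta> * \<bar>x\<bar>"
    using assms(1) by (simp add: abs_mult mult_right_mono)
  moreover have "\<bar>(t - s) * (t + s)\<bar> \<le> \<delta> * (2 * L)"
    unfolding abs_mult using assms by (intro mult_mono) auto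
  moreover have "- (x - t)\<^sup>2 / 2 = (t - s) * x - (t - s) * (t + s) / 2 + - (x - s)\<^sup>2 / 2"
    by (simp add: power2_eq_square field_simps)
  ultimately have "- \<delta> * L + (- \<delta> * \<bar>x\<bar> + - (x - s)\<^sup>2 / 2) \<le> - (x - t)\<^sup>2 / 2"
    by (simp add: abs_le_iff)
  then have "exp (- \<delta> * L) * (exp (- \<delta> * \<bar>x\<bar>) * exp (- (x - s)\<^sup>2 / 2)) \<le> exp (- (x - t)\<^sup>2 / 2)"
    by (simp only: exp_add[symmetric] exp_le_cancel_iff)
  then show ?thesis
    by (simp add: std_normal_density_def divide_right_mono)
qed

section \<open>Prior mass of atoms close to the true locations\<close>

lemma emeasure_uniform_near:
  fixes L s :: real
  assumes "0 < \<delta>" "\<delta> \<le> L" "\<bar>s\<bar> \<le> L"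
  shows "ennreal (\<delta> / (2 * L)) \<le> emeasure (uniform_measure lborel {-L..L}) ({-L..L} \<inter> {s - \<delta>..s + \<delta>})"
proof -
  \<comment> \<open>The half of the interval around \<open>s\<close> that points towards 0; it stays
    inside \<open>{-L..L}\<close> because \<open>\<delta> \<le> L\<close>.\<close>
  define a where "a = (if 0 \<le> s then s - \<delta> else s)"
  have "ennreal \<delta> = emeasure lborel {a..a + \<delta>}"
    using assms by simp
  also have "\<dots> \<le> emeasure lborel ({-L..L} \<inter> ({-L..L} \<inter> {s - \<delta>..s + \<delta>}))"
    using assms by (intro emeasure_mono) (auto simp: a_def)
  finally have "ennreal \<delta> / ennreal (2 * L) \<le>
      emeasure lborel ({-L..L} \<inter> ({-L..L} \<inter> {s - \<delta>..s + \<delta>})) / ennreal (2 * L)"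
    by (rule divide_right_mono_ennreal)
  then show ?thesis
    using assms by (simp add: divide_ennreal)
qed

lemma prob_space_uniform_interval: "0 < L \<Longrightarrow> prob_space (uniform_measure lborel {-L..L::real})"
  by (intro prob_space_uniform_measure) auto

lemma AE_uniform_interval: "AE x in uniform_measure lborel {-L..L::real}. \<bar>x\<bar> \<le> L"
  by (intro AE_uniform_measureI) auto

definition atom_lik :: "real \<Rightarrow> nat \<Rightarrow> (nat \<Rightarrow> real) \<Rightarrow> (nat \<Rightarrow> nat) \<Rightarrow> ennreal" where
  "atom_lik L n X z = (\<integral>\<^sup>+\<theta>. ennreal (\<Prod>i\<in>{1..n}. std_normal_density (X i - \<theta> (z i)))
    \<partial>(\<Pi>\<^sub>M j\<in>UNIV. uniform_measure lborel {-L..L}))"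

text \<open>Restrict to the event that each of the first \<open>k\<close> atoms is within
  \<open>\<delta>\<close> of its target \<open>s j\<close>. By independence it has prior probability
  at least \<open>(\<delta> / (2 * L)) ^ k\<close>, and on it
  \<open>std_normal_density_shift_ge\<close> bounds every factor of the likelihood.\<close>

lemma atom_lik_ge:
  assumes \<delta>: "0 < \<delta>" "\<delta> \<le> L" and z: "z \<in> {1..n} \<rightarrow> {..<k}" and s: "\<And>j. j < k \<Longrightarrow> \<bar>s j\<bar> \<le> L"
  shows "ennreal ((\<delta> / (2 * L)) ^ k * exp (- \<delta> * L) ^ n *
      (\<Prod>i\<in>{1..n}. exp (- \<delta> * \<bar>X i\<bar>) * std_normal_density (X i - s (z i)))) \<le> atom_lik L n X z"
proof -
  let ?H = "uniform_measure lborel {-L..L}"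
  let ?B = "\<lambda>j. {-L..L} \<inter> {s j - \<delta>..s j + \<delta>}"
  let ?c = "exp (- \<delta> * L) ^ n * (\<Prod>i\<in>{1..n}. exp (- \<delta> * \<bar>X i\<bar>) * std_normal_density (X i - s (z i)))"
  have c: "0 \<le> ?c"
    by (intro mult_nonneg_nonneg prod_nonneg) auto
  have "ennreal ((\<delta> / (2 * L)) ^ k) = (\<Prod>j<k. ennreal (\<delta> / (2 * L)))"
    using \<delta> by (simp add: ennreal_power)
  also have "\<dots> \<le> (\<Prod>j<k. emeasure ?H (?B j))"
    using \<delta> s by (intro prod_mono_ennreal emeasure_uniform_near) auto
  also have "\<dots> = (\<Prod>j<k. \<integral>\<^sup>+x. indicator (?B j) x \<partial>?H)"
    by (intro prod.cong refl nn_integral_indicator[symmetric]) auto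
  also have "\<dots> = (\<integral>\<^sup>+\<theta>. (\<Prod>j<k. indicator (?B j) (\<theta> j)) \<partial>(\<Pi>\<^sub>M j\<in>UNIV. ?H))"
    using \<delta> by (intro nn_integral_PiM_prod[symmetric] prob_space_uniform_interval) auto
  finally have "ennreal ?c * ennreal ((\<delta> / (2 * L)) ^ k) \<le>
      ennreal ?c * (\<integral>\<^sup>+\<theta>. (\<Prod>j<k. indicator (?B j) (\<theta> j)) \<partial>(\<Pi>\<^sub>M j\<in>UNIV. ?H))"
    by (rule mult_left_mono) simp
  also have "\<dots> = (\<integral>\<^sup>+\<theta>. ennreal ?c * (\<Prod>j<k. indicator (?B j) (\<theta> j)) \<partial>(\<Pi>\<^sub>M j\<in>UNIV. ?H))"
    by (rule nn_integral_cmult[symmetric]) measurable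
  also have "\<dots> \<le> atom_lik L n X z"
    unfolding atom_lik_def
  proof (rule nn_integral_mono)
    fix \<theta> :: "nat \<Rightarrow> real"
    show "ennreal ?c * (\<Prod>j<k. indicator (?B j) (\<theta> j)) \<le>
        ennreal (\<Prod>i\<in>{1..n}. std_normal_density (X i - \<theta> (z i)))"
    proof (cases "\<forall>j<k. \<theta> j \<in> ?B j")
      case True
      have "?c = (\<Prod>i\<in>{1..n}. exp (- \<delta> * L) * (exp (- \<delta> * \<bar>X i\<bar>) * std_normal_density (X i - s (z i))))"
        by (simp add: prod.distrib)
      also have "\<dots> \<le> (\<Prod>i\<in>{1..n}. std_normal_density (X i - \<theta> (z i)))"
      proof (intro prod_mono conjI std_normal_density_shift_ge)
        fix i assume "i \<in> {1..n}"
        then have "z i < k"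
          using z by auto
        then show "\<bar>\<theta> (z i) - s (z i)\<bar> \<le> \<delta>" "\<bar>\<theta> (z i)\<bar> \<le> L" "\<bar>s (z i)\<bar> \<le> L"
          using True s by (auto simp: abs_le_iff)
      qed auto
      finally have "ennreal ?c \<le> ennreal (\<Prod>i\<in>{1..n}. std_normal_density (X i - \<theta> (z i)))"
        by (rule ennreal_leI)
      moreover have "(\<Prod>j<k. indicator (?B j) (\<theta> j)) = (1::ennreal)"
        using True by (intro prod.neutral) auto
      ultimately show ?thesis by simp
    next
      case False
      then have "\<exists>j\<in>{..<k}. indicator (?B j) (\<theta> j) = (0::ennreal)"
        by (metis indicator_simps(2) lessThan_iff)
      then have "(\<Prod>j<k. indicator (?B j) (\<theta> j)) = (0::ennreal)"
        by (intro prod_zero) auto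
      then show ?thesis by (simp only: mult_zero_right zero_le)
    qed
  qed
  finally show ?thesis
    using \<delta> c by (simp add: ennreal_mult[symmetric] mult_ac)
qed


subsection \<open>Evidence and posterior\<close>

definition dp_prior :: "real \<Rightarrow> real \<Rightarrow> ((nat \<Rightarrow> real) \<times> (nat \<Rightarrow> real)) measure" where
  "dp_prior \<kappa> L = dirichlet_process \<kappa> (uniform_measure lborel {-L..L})"

definition joint_mass :: "real \<Rightarrow> real \<Rightarrow> nat \<Rightarrow> (nat \<Rightarrow> real) \<Rightarrow> (nat \<Rightarrow> nat) \<Rightarrow> ennreal" where
  "joint_mass \<kappa> L n X z = label_prob \<kappa> n z * atom_lik L n X z"

lemma countable_assignments: "countable (assignments n)"
  unfolding assignments_def by (intro countable_PiE) auto

lemma measurable_stick_breaking[measurable]: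
  "stick_breaking \<in> (\<Pi>\<^sub>M j\<in>UNIV. beta_distr a b) \<rightarrow>\<^sub>M (\<Pi>\<^sub>M j\<in>UNIV. borel)"
  by (rule measurable_PiM_single') (auto simp: space_PiM)

lemma sets_dp_prior[measurable_cong]:
  "sets (dp_prior \<kappa> L) = sets ((\<Pi>\<^sub>M j\<in>UNIV. borel) \<Otimes>\<^sub>M (\<Pi>\<^sub>M j\<in>UNIV. borel))"
  unfolding dp_prior_def dirichlet_process_def
  by (intro sets_pair_measure_cong sets_PiM_cong) auto

lemma measurable_complete_likelihood[measurable]:
  "(\<lambda>\<nu>. complete_likelihood n X \<nu> z) \<in> borel_measurable (dp_prior \<kappa> L)"
  unfolding complete_likelihood_def case_prod_beta by measurable

text \<open>Weights and atoms are independent under the prior, and for fixed labels the likelihood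
  is a function of the weights times a function of the atoms.\<close>

lemma nn_integral_complete_likelihood:
  assumes "0 < \<kappa>" "0 < L"
  shows "(\<integral>\<^sup>+\<nu>. complete_likelihood n X \<nu> z \<partial>dp_prior \<kappa> L) = joint_mass \<kappa> L n X z"
proof -
  let ?S = "\<Pi>\<^sub>M j\<in>(UNIV::nat set). beta_distr 1 \<kappa>"
  let ?W = "distr ?S (\<Pi>\<^sub>M j\<in>UNIV. borel) stick_breaking"
  let ?A = "\<Pi>\<^sub>M j\<in>(UNIV::nat set). uniform_measure lborel {-L..L}"
  interpret A: prob_space ?A
    using assms(2) by (intro prob_space_PiM prob_space_uniform_interval)
  have "(\<integral>\<^sup>+\<nu>. complete_likelihood n X \<nu> z \<partial>dp_prior \<kappa> L) =
      (\<integral>\<^sup>+w. \<integral>\<^sup>+\<theta>. complete_likelihood n X (w, \<theta>) z \<partial>?A \<partial>?W)"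
    using measurable_complete_likelihood[of n X z \<kappa> L]
    unfolding dp_prior_def dirichlet_process_def by (rule A.nn_integral_fst[symmetric])
  also have "\<dots> = (\<integral>\<^sup>+w. ennreal (\<Prod>i\<in>{1..n}. w (z i)) * atom_lik L n X z \<partial>?W)"
  proof (rule nn_integral_cong)
    fix w
    have "(\<integral>\<^sup>+\<theta>. complete_likelihood n X (w, \<theta>) z \<partial>?A) =
        (\<integral>\<^sup>+\<theta>. ennreal (\<Prod>i\<in>{1..n}. w (z i)) * ennreal (\<Prod>i\<in>{1..n}. std_normal_density (X i - \<theta> (z i))) \<partial>?A)"
      \<comment> \<open>Here \<open>w\<close> is an arbitrary real sequence; nonnegativity of the
        normal factors alone lets \<open>ennreal\<close> split the product.\<close>
      by (intro nn_integral_cong)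
         (simp add: complete_likelihood_def prod.distrib ennreal_mult'' prod_nonneg mult.commute)
    then show "(\<integral>\<^sup>+\<theta>. complete_likelihood n X (w, \<theta>) z \<partial>?A) =
        ennreal (\<Prod>i\<in>{1..n}. w (z i)) * atom_lik L n X z"
      unfolding atom_lik_def by (subst nn_integral_cmult[symmetric]) auto
  qed
  also have "\<dots> = (\<integral>\<^sup>+w. ennreal (\<Prod>i\<in>{1..n}. w (z i)) \<partial>?W) * atom_lik L n X z"
    by (rule nn_integral_multc) measurable
  also have "(\<integral>\<^sup>+w. ennreal (\<Prod>i\<in>{1..n}. w (z i)) \<partial>?W) = label_prob \<kappa> n z"
    unfolding label_prob_def by (subst nn_integral_distr) auto
  finally show ?thesis
    unfolding joint_mass_def .
qed

lemma evidence_dp_prior: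
  assumes "0 < \<kappa>" "0 < L"
  shows "evidence (dp_prior \<kappa> L) n X = (\<integral>\<^sup>+z. joint_mass \<kappa> L n X z \<partial>count_space (assignments n))"
  unfolding evidence_def using countable_assignments
  by (subst nn_integral_count_space_nn_integral)
     (auto simp: nn_integral_complete_likelihood assms)

text \<open>Tonelli in the countable label space moves the prior integral inside, where it turns the
  likelihood into \<open>joint_mass\<close>.\<close>

lemma posterior_prob_clusters_gt_eq:
  assumes "0 < \<kappa>" "0 < L"
  shows "posterior_prob_clusters_gt (dp_prior \<kappa> L) n X t =
    (\<integral>\<^sup>+z. indicator {z. t < real (num_clusters n z)} z * joint_mass \<kappa> L n X z \<partial>count_space (assignments n)) /
      evidence (dp_prior \<kappa> L) n X"
proof -
  let ?P = "dp_prior \<kappa> L" and ?C = "count_space (assignments n)"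
  let ?D = "evidence ?P n X"
  let ?I = "\<lambda>z. indicator {z. t < real (num_clusters n z)} z :: ennreal"
  let ?S = "{(\<nu>, z) \<in> space (posterior ?P n X). t < real (num_clusters n z)}"
  interpret C: sigma_finite_measure ?C
    by (rule sigma_finite_measure_count_space_countable[OF countable_assignments])
  \<comment> \<open>With a countable discrete second factor, joint measurability follows from that
    of the sections at fixed labels.\<close>
  have meas: "h \<in> borel_measurable (?P \<Otimes>\<^sub>M ?C)"
    if "\<And>z. (\<lambda>\<nu>. h (\<nu>, z)) \<in> borel_measurable ?P" for h :: "_ \<Rightarrow> ennreal"
  proof -
    have "(\<lambda>(z, \<nu>). h (\<nu>, z)) \<in> borel_measurable (?C \<Otimes>\<^sub>M ?P)"
      by (rule measurable_pair_measure_countable1[OF countable_assignments]) (simp add: that)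
    then show ?thesis
      by (subst measurable_pair_swap_iff) (simp add: case_prod_beta)
  qed
  have ind: "(\<lambda>p. ?I (snd p)) \<in> borel_measurable (?P \<Otimes>\<^sub>M ?C)"
    by (rule meas) simp
  have lik: "(\<lambda>(\<nu>, z). complete_likelihood n X \<nu> z / ?D) \<in> borel_measurable (?P \<Otimes>\<^sub>M ?C)"
    by (rule meas) (simp add: borel_measurable_divide_ennreal)
  have S: "?S \<in> sets (?P \<Otimes>\<^sub>M ?C)"
  proof -
    have "?S = {p \<in> space (?P \<Otimes>\<^sub>M ?C). ?I (snd p) \<noteq> 0}"
      by (auto simp: posterior_def indicator_def)
    also have "\<dots> \<in> sets (?P \<Otimes>\<^sub>M ?C)"
      using ind by measurable
    finally show ?thesis .
  qed
  have "posterior_prob_clusters_gt ?P n X t =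
      (\<integral>\<^sup>+p. (case p of (\<nu>, z) \<Rightarrow> complete_likelihood n X \<nu> z / ?D) * indicator ?S p \<partial>(?P \<Otimes>\<^sub>M ?C))"
    unfolding posterior_prob_clusters_gt_def
    by (subst (1) posterior_def, rule emeasure_density[OF lik S])
  also have "\<dots> = (\<integral>\<^sup>+p. ?I (snd p) * complete_likelihood n X (fst p) (snd p) / ?D \<partial>(?P \<Otimes>\<^sub>M ?C))"
    by (intro nn_integral_cong) (auto simp: posterior_def indicator_def)
  also have "\<dots> = (\<integral>\<^sup>+\<nu>. \<integral>\<^sup>+z. ?I z * complete_likelihood n X \<nu> z / ?D \<partial>?C \<partial>?P)"
    by (subst C.nn_integral_fst[symmetric])
       (auto intro!: meas borel_measurable_divide_ennreal)
  also have "\<dots> = (\<integral>\<^sup>+z. \<integral>\<^sup>+\<nu>. ?I z * complete_likelihood n X \<nu> z / ?D \<partial>?P \<partial>?C)"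
    by (intro nn_integral_count_space_nn_integral countable_assignments borel_measurable_divide_ennreal) auto
  also have "\<dots> = (\<integral>\<^sup>+z. ?I z * joint_mass \<kappa> L n X z / ?D \<partial>?C)"
    by (intro nn_integral_cong)
       (simp add: nn_integral_divide nn_integral_cmult nn_integral_complete_likelihood assms)
  also have "\<dots> = (\<integral>\<^sup>+z. ?I z * joint_mass \<kappa> L n X z \<partial>?C) / ?D"
    by (rule nn_integral_divide) simp
  finally show ?thesis .
qed

text \<open>For each label sequence in the \<open>k\<close> true components, multiply the bounds for
  its label probability and its atom likelihood. The prefactor is the same for all these sequences,
  so the remaining products can be summed, and distributivity reassembles the mixture density at
  every observation.\<close>

lemma evidence_ge:
  assumes \<kappa>: "0 < \<kappa>" "\<kappa> \<le> 1" and \<delta>: "0 < \<delta>" "\<delta> \<le> L"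
    and w: "\<And>j. j < k \<Longrightarrow> 0 \<le> w j" "(\<Sum>j<k. w j) = 1" and s: "\<And>j. j < k \<Longrightarrow> \<bar>s j\<bar> \<le> L"
  shows "ennreal ((\<kappa> / (real n + 1) * (\<delta> / (2 * L))) ^ k * exp (- \<delta> * L) ^ n *
      (\<Prod>i\<in>{1..n}. exp (- \<delta> * \<bar>X i\<bar>) * mixture_density k w s (X i))) \<le> evidence (dp_prior \<kappa> L) n X"
proof -
  let ?Z = "{1..n} \<rightarrow>\<^sub>E {..<k}"
  let ?f = "\<lambda>i. exp (- \<delta> * \<bar>X i\<bar>)" and ?\<phi> = "\<lambda>i j. std_normal_density (X i - s j)"
  let ?c = "(\<kappa> / (real n + 1)) ^ k" and ?d = "(\<delta> / (2 * L)) ^ k * exp (- \<delta> * L) ^ n"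
  have summand: "ennreal (?c * ?d * (\<Prod>i\<in>{1..n}. w (z i) * (?f i * ?\<phi> i (z i)))) \<le> joint_mass \<kappa> L n X z"
    if z: "z \<in> ?Z" for z
  proof -
    have z': "z \<in> {1..n} \<rightarrow> {..<k}"
      using z by auto
    have nonneg: "0 \<le> (\<Prod>i\<in>{1..n}. w (z i))" "0 \<le> (\<Prod>i\<in>{1..n}. ?f i * ?\<phi> i (z i))"
      using z w(1) by (auto intro!: prod_nonneg simp: PiE_iff)
    have "ennreal (?c * ?d * (\<Prod>i\<in>{1..n}. w (z i) * (?f i * ?\<phi> i (z i)))) =
        ennreal (?c * (\<Prod>i\<in>{1..n}. w (z i))) * ennreal (?d * (\<Prod>i\<in>{1..n}. ?f i * ?\<phi> i (z i)))"
    proof (subst ennreal_mult[symmetric])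
      show "0 \<le> ?c * (\<Prod>i\<in>{1..n}. w (z i))" "0 \<le> ?d * (\<Prod>i\<in>{1..n}. ?f i * ?\<phi> i (z i))"
        using nonneg \<kappa> \<delta> by (auto intro!: mult_nonneg_nonneg[OF _ nonneg(1)] mult_nonneg_nonneg[OF _ nonneg(2)])
    qed (simp only: prod.distrib mult_ac)
    also have "\<dots> \<le> label_prob \<kappa> n z * atom_lik L n X z"
      using \<kappa> \<delta> w s z' by (intro mult_mono label_prob_ge atom_lik_ge) auto
    finally show ?thesis unfolding joint_mass_def .
  qed
  have "(\<Prod>i\<in>{1..n}. ?f i * mixture_density k w s (X i)) =
      (\<Prod>i\<in>{1..n}. \<Sum>j<k. w j * (?f i * ?\<phi> i j))"
    unfolding mixture_density_def by (simp only: sum_distrib_left mult_ac)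
  also have "\<dots> = (\<Sum>z\<in>?Z. \<Prod>i\<in>{1..n}. w (z i) * (?f i * ?\<phi> i (z i)))"
    by (rule prod_sum_PiE) auto
  finally have "ennreal (?c * ?d * (\<Prod>i\<in>{1..n}. ?f i * mixture_density k w s (X i))) =
      ennreal (\<Sum>z\<in>?Z. ?c * ?d * (\<Prod>i\<in>{1..n}. w (z i) * (?f i * ?\<phi> i (z i))))"
    by (simp only: sum_distrib_left)
  also have "\<dots> = (\<Sum>z\<in>?Z. ennreal (?c * ?d * (\<Prod>i\<in>{1..n}. w (z i) * (?f i * ?\<phi> i (z i)))))"
    using w(1) \<kappa> \<delta> by (intro sum_ennreal[symmetric] mult_nonneg_nonneg prod_nonneg ballI)
      (auto simp: PiE_iff)
  also have "\<dots> \<le> (\<Sum>z\<in>?Z. joint_mass \<kappa> L n X z)"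
    by (rule sum_mono) (rule summand)
  also have "\<dots> = (\<integral>\<^sup>+z. joint_mass \<kappa> L n X z * indicator ?Z z \<partial>count_space (assignments n))"
    by (subst nn_integral_count_space'[of ?Z])
       (auto intro!: finite_PiE simp: assignments_def PiE_iff)
  also have "\<dots> \<le> (\<integral>\<^sup>+z. joint_mass \<kappa> L n X z \<partial>count_space (assignments n))"
    by (intro nn_integral_mono) (auto simp: indicator_def)
  also have "\<dots> = evidence (dp_prior \<kappa> L) n X"
    using \<kappa> \<delta> by (simp add: evidence_dp_prior)
  finally show ?thesis
    by (simp only: power_mult_distrib mult_ac)
qed

text \<open>After exchanging the integrals over data and atoms, the observations are independent for
  fixed atoms, and the true density cancels in each coordinate. What is left is an exponential
  moment of a single normal law, bounded uniformly in the labels and in \<open>k\<close>.\<close>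

lemma nn_integral_atom_lik_ratio_le:
  assumes L: "0 < L" and \<delta>: "0 \<le> \<delta>" "\<delta> \<le> 1"
    and w: "\<And>j. j < k \<Longrightarrow> 0 \<le> w j" "(\<Sum>j<k. w j) = 1"
  shows "(\<integral>\<^sup>+X. atom_lik L n X z *
      ennreal (\<Prod>i\<in>{1..n}. exp (\<delta> * \<bar>X i\<bar>) / mixture_density k w s (X i))
      \<partial>iid_sample n (gaussian_mixture (atomic_mixture k w s)))
    \<le> ennreal ((1 + \<delta> * (2 * exp (L + 1 / 2))) ^ n)"
proof -
  let ?g = "mixture_density k w s" and ?K = "1 + \<delta> * (2 * exp (L + 1 / 2))"
  let ?G = "gaussian_mixture (atomic_mixture k w s)"
  let ?A = "\<Pi>\<^sub>M j\<in>(UNIV::nat set). uniform_measure lborel {-L..L}"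
  have gpos: "0 < ?g x" for x
    using w by (rule mixture_density_pos)
  interpret G: prob_space ?G
    using w by (rule prob_space_gaussian_mixture)
  interpret A: prob_space ?A
    using L by (intro prob_space_PiM prob_space_uniform_interval)
  interpret X: prob_space "\<Pi>\<^sub>M i\<in>{1..n}. ?G"
    by (intro prob_space_PiM G.prob_space_axioms)
  interpret XA: pair_sigma_finite "\<Pi>\<^sub>M i\<in>{1..n}. ?G" ?A ..
  let ?h = "\<lambda>t x. std_normal_density (x - t) * (exp (\<delta> * \<bar>x\<bar>) / ?g x)"
  have h: "0 \<le> ?h t x" for t x
    using gpos[of x] by simp
  have "(\<integral>\<^sup>+X. atom_lik L n X z * ennreal (\<Prod>i\<in>{1..n}. exp (\<delta> * \<bar>X i\<bar>) / ?g (X i)) \<partial>iid_sample n ?G) =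
      (\<integral>\<^sup>+X. \<integral>\<^sup>+\<theta>. (\<Prod>i\<in>{1..n}. ennreal (?h (\<theta> (z i)) (X i))) \<partial>?A \<partial>(\<Pi>\<^sub>M i\<in>{1..n}. ?G))"
    unfolding iid_sample_def
  proof (rule nn_integral_cong)
    fix X :: "nat \<Rightarrow> real"
    have "atom_lik L n X z * ennreal (\<Prod>i\<in>{1..n}. exp (\<delta> * \<bar>X i\<bar>) / ?g (X i)) =
        (\<integral>\<^sup>+\<theta>. ennreal (\<Prod>i\<in>{1..n}. std_normal_density (X i - \<theta> (z i))) *
          ennreal (\<Prod>i\<in>{1..n}. exp (\<delta> * \<bar>X i\<bar>) / ?g (X i)) \<partial>?A)"
      unfolding atom_lik_def by (rule nn_integral_multc[symmetric]) measurable
    also have "\<dots> = (\<integral>\<^sup>+\<theta>. (\<Prod>i\<in>{1..n}. ennreal (?h (\<theta> (z i)) (X i))) \<partial>?A)"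
      using h less_imp_le[OF gpos] by (intro nn_integral_cong)
        (simp only: prod_ennreal prod.distrib[symmetric] ennreal_mult[symmetric] prod_nonneg
          normal_density_nonneg divide_nonneg_nonneg exp_ge_zero)
    finally show "atom_lik L n X z * ennreal (\<Prod>i\<in>{1..n}. exp (\<delta> * \<bar>X i\<bar>) / ?g (X i)) =
        (\<integral>\<^sup>+\<theta>. (\<Prod>i\<in>{1..n}. ennreal (?h (\<theta> (z i)) (X i))) \<partial>?A)" .
  qed
  also have "\<dots> = (\<integral>\<^sup>+\<theta>. \<integral>\<^sup>+X. (\<Prod>i\<in>{1..n}. ennreal (?h (\<theta> (z i)) (X i))) \<partial>(\<Pi>\<^sub>M i\<in>{1..n}. ?G) \<partial>?A)"
    by (rule XA.Fubini'[symmetric]) measurable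
  also have "\<dots> \<le> (\<integral>\<^sup>+\<theta>. ennreal (?K ^ n) \<partial>?A)"
  proof (rule nn_integral_mono_AE)
    \<comment> \<open>The constant in the exponential moment bound requires centres in
      \<open>{-L..L}\<close>, which holds for almost every atom sequence.\<close>
    have "AE \<theta> in ?A. \<forall>j. \<bar>\<theta> j\<bar> \<le> L"
      unfolding AE_all_countable
      using L by (intro allI AE_PiM_component prob_space_uniform_interval AE_uniform_interval) auto
    then show "AE \<theta> in ?A. (\<integral>\<^sup>+X. (\<Prod>i\<in>{1..n}. ennreal (?h (\<theta> (z i)) (X i))) \<partial>(\<Pi>\<^sub>M i\<in>{1..n}. ?G)) \<le> ennreal (?K ^ n)"
    proof (rule AE_mp, intro AE_I2 impI)
      fix \<theta> :: "nat \<Rightarrow> real" assume \<theta>: "\<forall>j. \<bar>\<theta> j\<bar> \<le> L"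
      have "(\<integral>\<^sup>+X. (\<Prod>i\<in>{1..n}. ennreal (?h (\<theta> (z i)) (X i))) \<partial>(\<Pi>\<^sub>M i\<in>{1..n}. ?G)) =
          (\<Prod>i\<in>{1..n}. \<integral>\<^sup>+x. ennreal (?h (\<theta> (z i)) x) \<partial>?G)"
        by (intro nn_integral_PiM_prod G.prob_space_axioms) auto
      also have "\<dots> \<le> (\<Prod>i\<in>{1..n}. ennreal ?K)"
      proof (rule prod_mono_ennreal)
        fix i
        have "(\<integral>\<^sup>+x. ennreal (?h (\<theta> (z i)) x) \<partial>?G) =
            (\<integral>\<^sup>+x. ennreal (?g x) * ennreal (?h (\<theta> (z i)) x) \<partial>lborel)"
          using w by (rule nn_integral_gaussian_mixture) auto
        also have "\<dots> = (\<integral>\<^sup>+x. ennreal (std_normal_density (x - \<theta> (z i)) * exp (\<delta> * \<bar>x\<bar>)) \<partial>lborel)"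
          using less_imp_le[OF gpos] less_imp_neq[OF gpos] h
          by (intro nn_integral_cong) (simp add: ennreal_mult[symmetric])
        also have "\<dots> \<le> ennreal ?K"
          using \<theta> \<delta> by (intro nn_integral_normal_exp_abs) auto
        finally show "(\<integral>\<^sup>+x. ennreal (?h (\<theta> (z i)) x) \<partial>?G) \<le> ennreal ?K" .
      qed
      also have "\<dots> = ennreal (?K ^ n)"
        using \<delta> by (simp add: ennreal_power del: ennreal_plus)
      finally show "(\<integral>\<^sup>+X. (\<Prod>i\<in>{1..n}. ennreal (?h (\<theta> (z i)) (X i))) \<partial>(\<Pi>\<^sub>M i\<in>{1..n}. ?G)) \<le> ennreal (?K ^ n)" .
    qed
  qed
  also have "\<dots> = ennreal (?K ^ n)"
    by (simp add: A.emeasure_space_1)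
  finally show ?thesis .
qed


subsection \<open>Expected posterior probability of many clusters\<close>

lemma measurable_atom_lik[measurable]:
  assumes "0 < L" and "z \<in> assignments n"
  shows "(\<lambda>X. atom_lik L n X z) \<in> borel_measurable (\<Pi>\<^sub>M i\<in>{1..n}. gaussian_mixture \<nu>)"
proof -
  interpret A: prob_space "\<Pi>\<^sub>M j\<in>(UNIV::nat set). uniform_measure lborel {-L..L}"
    using assms(1) by (intro prob_space_PiM prob_space_uniform_interval)
  show ?thesis
    unfolding atom_lik_def by measurable
qed

text \<open>No positivity is assumed because \<open>inverse 0\<close> is the top element; the
  evidence may take any extended value.\<close>

lemma ennreal_inverse_antimono: "x \<le> y \<Longrightarrow> inverse y \<le> inverse (x::ennreal)"
  by (simp add: less_eq_ennreal.rep_eq inverse_ennreal.rep_eq ereal_inverse_antimono)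

text \<open>Replacing the evidence by its lower bound leaves a sum over labels in which the data
  enter only through \<open>atom_lik\<close> and the density ratio. The ratio bound integrates out
  the data and the prior cluster bound handles the labels.\<close>

lemma expected_posterior_clusters_gt_le:
  assumes \<kappa>: "0 < \<kappa>" "\<kappa> \<le> 1" and n: "0 < n" and L: "1 / real n \<le> L"
    and w: "\<And>j. j < k \<Longrightarrow> 0 \<le> w j" "(\<Sum>j<k. w j) = 1" and s: "\<And>j. j < k \<Longrightarrow> \<bar>s j\<bar> \<le> L"
  shows "(\<integral>\<^sup>+X. posterior_prob_clusters_gt (dp_prior \<kappa> L) n X (real m)
      \<partial>iid_sample n (gaussian_mixture (atomic_mixture k w s)))
    \<le> ennreal (exp (L + 2 * exp (L + 1 / 2)) * (real n * (real n + 1)) *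
        (2 * L * (real n * (real n + 1)) / \<kappa>) ^ k * \<kappa> ^ m)"
proof -
  let ?g = "mixture_density k w s" and ?G = "gaussian_mixture (atomic_mixture k w s)"
  let ?C = "count_space (assignments n)"
  let ?I = "\<lambda>z. indicator {z. m < num_clusters n z} z :: ennreal"
  \<comment> \<open>With this choice the errors \<open>exp (\<delta> * L) ^ n\<close> and
    \<open>(1 + \<delta> * K) ^ n\<close> stay bounded in \<open>n\<close>, at the price of one
    factor \<open>n\<close> per true component.\<close>
  define \<delta> where "\<delta> = 1 / real n"
  have \<delta>: "0 < \<delta>" "\<delta> \<le> 1" "\<delta> \<le> L" "real n * \<delta> = 1"
    using n L by (auto simp: \<delta>_def)
  then have L_pos: "0 < L" by simp
  \<comment> \<open>\<open>\<Delta> * R X\<close> is the reciprocal of the lower bound in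
    \<open>evidence_ge\<close>: \<open>R\<close> carries the dependence on the data and
    \<open>\<Delta>\<close> the prior cost of the \<open>k\<close> components.\<close>
  define R where "R X = (\<Prod>i\<in>{1..n}. exp (\<delta> * \<bar>X i\<bar>) / ?g (X i))" for X
  define \<Delta> where "\<Delta> = (2 * L * (real n * (real n + 1)) / \<kappa>) ^ k * exp L"
  define K where "K = 2 * exp (L + 1 / 2)"
  have gpos: "0 < ?g x" for x
    using w by (rule mixture_density_pos)
  have R_pos: "0 < R X" for X
    unfolding R_def using gpos by (intro prod_pos) auto
  have \<Delta>_pos: "0 < \<Delta>"
    unfolding \<Delta>_def using \<kappa> L_pos n by simp
  have R_measurable: "R \<in> borel_measurable (\<Pi>\<^sub>M i\<in>{1..n}. ?G)"
    unfolding R_def[abs_def] by measurable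
  have evidence: "ennreal (1 / (\<Delta> * R X)) \<le> evidence (dp_prior \<kappa> L) n X" for X
  proof -
    have "(\<Prod>i\<in>{1..n}. exp (- \<delta> * \<bar>X i\<bar>) * ?g (X i)) = 1 / R X"
      unfolding R_def prod_inversef[symmetric] inverse_eq_divide[symmetric]
      by (intro prod.cong) (auto simp: exp_minus field_simps)
    moreover have "exp (- \<delta> * L) ^ n = 1 / exp L"
    proof -
      have "exp (- \<delta> * L) ^ n = exp (- (real n * \<delta>) * L)"
        by (simp add: exp_of_nat_mult[symmetric] mult_ac)
      then show ?thesis
        by (simp only: \<delta>(4)) (simp add: exp_minus inverse_eq_divide)
    qed
    moreover have "(\<kappa> / (real n + 1) * (\<delta> / (2 * L))) ^ k = 1 / (2 * L * (real n * (real n + 1)) / \<kappa>) ^ k"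
      by (simp add: \<delta>_def power_divide[symmetric] mult_ac flip: power_one_over)
    ultimately have "(\<kappa> / (real n + 1) * (\<delta> / (2 * L))) ^ k * exp (- \<delta> * L) ^ n *
        (\<Prod>i\<in>{1..n}. exp (- \<delta> * \<bar>X i\<bar>) * ?g (X i)) = 1 / (\<Delta> * R X)"
      by (simp add: \<Delta>_def)
    then show ?thesis
      using evidence_ge[of \<kappa> \<delta> L k w s n X] \<kappa> \<delta> w s by simp
  qed
  have "(\<integral>\<^sup>+X. posterior_prob_clusters_gt (dp_prior \<kappa> L) n X (real m) \<partial>iid_sample n ?G) \<le>
      (\<integral>\<^sup>+X. \<integral>\<^sup>+z. ?I z * label_prob \<kappa> n z * ennreal \<Delta> * (atom_lik L n X z * ennreal (R X)) \<partial>?C \<partial>iid_sample n ?G)"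
  proof (rule nn_integral_mono)
    fix X :: "nat \<Rightarrow> real"
    have inv: "inverse (evidence (dp_prior \<kappa> L) n X) \<le> ennreal (\<Delta> * R X)"
      using ennreal_inverse_antimono[OF evidence[of X]] \<Delta>_pos R_pos[of X] by (simp add: inverse_ennreal)
    have "posterior_prob_clusters_gt (dp_prior \<kappa> L) n X (real m) =
        (\<integral>\<^sup>+z. ?I z * joint_mass \<kappa> L n X z \<partial>?C) * inverse (evidence (dp_prior \<kappa> L) n X)"
      using \<kappa> L_pos by (simp add: posterior_prob_clusters_gt_eq divide_ennreal_def)
    also have "\<dots> \<le> (\<integral>\<^sup>+z. ?I z * joint_mass \<kappa> L n X z \<partial>?C) * ennreal (\<Delta> * R X)"
      by (rule mult_left_mono[OF inv]) simp
    also have "\<dots> = (\<integral>\<^sup>+z. ?I z * joint_mass \<kappa> L n X z * ennreal (\<Delta> * R X) \<partial>?C)"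
      by (rule nn_integral_multc[symmetric]) simp
    also have "\<dots> = (\<integral>\<^sup>+z. ?I z * label_prob \<kappa> n z * ennreal \<Delta> * (atom_lik L n X z * ennreal (R X)) \<partial>?C)"
      using \<Delta>_pos R_pos[of X] by (simp add: joint_mass_def ennreal_mult less_imp_le mult_ac)
    finally show "posterior_prob_clusters_gt (dp_prior \<kappa> L) n X (real m) \<le>
        (\<integral>\<^sup>+z. ?I z * label_prob \<kappa> n z * ennreal \<Delta> * (atom_lik L n X z * ennreal (R X)) \<partial>?C)" .
  qed
  also have "\<dots> = (\<integral>\<^sup>+z. \<integral>\<^sup>+X. ?I z * label_prob \<kappa> n z * ennreal \<Delta> * (atom_lik L n X z * ennreal (R X))
      \<partial>iid_sample n ?G \<partial>?C)"
    unfolding iid_sample_def using R_measurable measurable_atom_lik[OF L_pos]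
    by (intro nn_integral_count_space_nn_integral countable_assignments) auto
  also have "\<dots> \<le> (\<integral>\<^sup>+z. ?I z * label_prob \<kappa> n z * ennreal (\<Delta> * exp K) \<partial>?C)"
  proof (rule nn_integral_mono)
    fix z assume "z \<in> space ?C"
    then have z: "z \<in> assignments n" by simp
    have "(1 + \<delta> * K) ^ n \<le> exp (\<delta> * K) ^ n"
      using \<delta> by (intro power_mono exp_ge_add_one_self) (auto simp: K_def)
    also have "\<dots> = exp K"
      using \<delta>(4) by (simp add: exp_of_nat_mult[symmetric] mult.assoc[symmetric])
    finally have exp_K: "ennreal ((1 + \<delta> * K) ^ n) \<le> ennreal (exp K)"
      by (rule ennreal_leI)
    have "(\<integral>\<^sup>+X. atom_lik L n X z * ennreal (R X) \<partial>iid_sample n ?G) \<le> ennreal ((1 + \<delta> * K) ^ n)"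
      unfolding R_def K_def using L_pos \<delta> w by (intro nn_integral_atom_lik_ratio_le) auto
    also note exp_K
    finally have ratio: "(\<integral>\<^sup>+X. atom_lik L n X z * ennreal (R X) \<partial>iid_sample n ?G) \<le> ennreal (exp K)" .
    have "(\<integral>\<^sup>+X. ?I z * label_prob \<kappa> n z * ennreal \<Delta> * (atom_lik L n X z * ennreal (R X)) \<partial>iid_sample n ?G) =
        ?I z * label_prob \<kappa> n z * ennreal \<Delta> * (\<integral>\<^sup>+X. atom_lik L n X z * ennreal (R X) \<partial>iid_sample n ?G)"
      unfolding iid_sample_def using R_measurable measurable_atom_lik[OF L_pos z]
      by (intro nn_integral_cmult) auto
    also have "\<dots> \<le> ?I z * label_prob \<kappa> n z * ennreal \<Delta> * ennreal (exp K)"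
      by (rule mult_left_mono[OF ratio]) simp
    finally show "(\<integral>\<^sup>+X. ?I z * label_prob \<kappa> n z * ennreal \<Delta> * (atom_lik L n X z * ennreal (R X)) \<partial>iid_sample n ?G)
        \<le> ?I z * label_prob \<kappa> n z * ennreal (\<Delta> * exp K)"
      using \<Delta>_pos by (simp add: ennreal_mult mult.assoc)
  qed
  also have "\<dots> = (\<integral>\<^sup>+z. ?I z * label_prob \<kappa> n z \<partial>?C) * ennreal (\<Delta> * exp K)"
    by (rule nn_integral_multc) simp
  also have "\<dots> \<le> ennreal (\<kappa> ^ m * (real n * (real n + 1))) * ennreal (\<Delta> * exp K)"
    using \<kappa> n by (intro mult_right_mono label_prob_clusters_gt) auto
  also have "\<dots> = ennreal (\<kappa> ^ m * (real n * (real n + 1)) * (\<Delta> * exp K))"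
    using \<kappa> \<Delta>_pos by (intro ennreal_mult[symmetric]) auto
  also have "\<kappa> ^ m * (real n * (real n + 1)) * (\<Delta> * exp K) =
      exp (L + K) * (real n * (real n + 1)) * (2 * L * (real n * (real n + 1)) / \<kappa>) ^ k * \<kappa> ^ m"
    by (simp only: \<Delta>_def exp_add mult_ac)
  finally show ?thesis
    unfolding K_def .
qed

section \<open>Choice of the constant, and convergence uniformly in the number of components\<close>

theorem theorem3p1:
  fixes L a0 :: real and \<kappa> :: "nat \<Rightarrow> real"
  assumes "0 < L" and "0 < a0"
    and "\<And>n. 1 \<le> n \<Longrightarrow> 0 < \<kappa> n"
    and "\<exists>C1>0. \<exists>C2>0. \<forall>n\<ge>1.
           C1 * real n powr (- a0) \<le> \<kappa> n \<and> \<kappa> n \<le> C2 * real n powr (- a0)"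
  shows "\<exists>C::real. 1 < C \<and>
    (\<forall>kstar::nat \<Rightarrow> nat. (\<forall>n. 0 < kstar n) \<longrightarrow>
      (\<lambda>n. SUP \<nu>\<in>mixing_distributions L (kstar n).
         \<integral>\<^sup>+ X. posterior_prob_clusters_gt
                (dirichlet_process (\<kappa> n) (uniform_measure lborel {-L..L})) n X
                (C * real (kstar n))
           \<partial>iid_sample n (gaussian_mixture \<nu>))
      \<longlonglongrightarrow> 0)"
proof -
  obtain C2 where C2: "0 < C2" "\<And>n. 1 \<le> n \<Longrightarrow> \<kappa> n \<le> C2 * real n powr (- a0)"
    using assms(4) by blast
  \<comment> \<open>Makes \<open>\<kappa> n ^ c\<close> of order at most \<open>n\<close> to the
    power -5: two powers of \<open>n\<close> pay for each component, two for the global factor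
    \<open>n (n + 1)\<close>, and one is left for convergence. The final constant is
    \<open>Suc c\<close>, whose additional factor \<open>\<kappa>\<close> cancels the division by
    \<open>\<kappa>\<close> in the evidence bound.\<close>
  define c where "c = Suc (nat \<lceil>5 / a0\<rceil>)"
  have c: "5 \<le> a0 * real c"
  proof -
    have "5 / a0 \<le> real c"
      unfolding c_def by linarith
    then show ?thesis
      using assms(2) by (simp add: field_simps)
  qed
  define M where "M = exp (L + 2 * exp (L + 1 / 2))"
  define Q where "Q = 4 * L * C2 ^ c"
  have Q: "0 < Q" and M: "0 < M"
    using assms(1) C2(1) by (simp_all add: Q_def M_def)
  \<comment> \<open>Neither the bound nor the conditions on \<open>n\<close> involve
    \<open>k\<close>, so the growth of \<open>kstar\<close> does not affect the rate.\<close>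
  have bound: "(SUP \<nu>\<in>mixing_distributions L k. \<integral>\<^sup>+X. posterior_prob_clusters_gt
        (dirichlet_process (\<kappa> n) (uniform_measure lborel {-L..L})) n X (real (Suc c) * real k)
        \<partial>iid_sample n (gaussian_mixture \<nu>)) \<le> ennreal (2 * M * Q / real n)"
    if n: "1 \<le> n" and "1 / real n \<le> L" and small: "\<kappa> n \<le> 1" "Q / real n ^ 3 \<le> 1" and k: "0 < k" for n k
  proof (rule SUP_least)
    fix \<nu> assume "\<nu> \<in> mixing_distributions L k"
    then obtain w s where \<nu>: "\<nu> = atomic_mixture k w s" and w: "\<And>j. j < k \<Longrightarrow> 0 \<le> w j" "(\<Sum>j<k. w j) = 1"
      and s: "\<And>j. j < k \<Longrightarrow> s j \<in> {-L..L}"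
      unfolding mixing_distributions_def by blast
    have s: "\<bar>s j\<bar> \<le> L" if "j < k" for j
      using s[OF that] by (auto simp: abs_le_iff)
    have \<kappa>: "0 < \<kappa> n"
      using assms(3) n by simp
    \<comment> \<open>The net factor of one component: its cost
      \<open>2 * L * (n * (n + 1)) / \<kappa> n\<close> times its share
      \<open>\<kappa> n ^ Suc c\<close> of the cluster penalty.\<close>
    define q where "q = 2 * L * (real n * (real n + 1)) * \<kappa> n ^ c"
    have n2: "real n * (real n + 1) \<le> 2 * real n ^ 2"
      using n by (simp add: power2_eq_square algebra_simps)
    have "\<kappa> n ^ c \<le> (C2 * real n powr (- a0)) ^ c"
      using \<kappa> C2(2)[OF n] by (intro power_mono) auto
    also have "\<dots> = C2 ^ c * real n powr (- (a0 * real c))"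
      using n by (simp add: power_mult_distrib powr_powr flip: powr_realpow)
    also have "\<dots> \<le> C2 ^ c * real n powr (- 5)"
      using n c C2(1) by (intro mult_left_mono powr_mono) auto
    also have "real n powr (- 5) = 1 / real n ^ 5"
      using n by (simp add: powr_minus_divide)
    finally have "q \<le> 2 * L * (2 * real n ^ 2) * (C2 ^ c * (1 / real n ^ 5))"
      unfolding q_def using assms(1) \<kappa> by (intro mult_mono[OF mult_left_mono[OF n2]]) auto
    also have "\<dots> = Q / real n ^ 3"
    proof -
      have n5: "real n ^ 5 = real n * real n * (real n * real n * real n)"
        by (simp add: numeral_eq_Suc)
      show ?thesis
        unfolding Q_def n5 power2_eq_square power3_eq_cube using n by (simp add: divide_simps)
    qed
    finally have q: "q \<le> Q / real n ^ 3" .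
    have q0: "0 \<le> q"
      unfolding q_def using assms(1) \<kappa> by simp
    have "(2 * L * (real n * (real n + 1)) / \<kappa> n) ^ k * \<kappa> n ^ (Suc c * k) =
        (2 * L * (real n * (real n + 1)) / \<kappa> n * \<kappa> n ^ Suc c) ^ k"
      by (simp only: power_mult_distrib power_mult)
    also have "2 * L * (real n * (real n + 1)) / \<kappa> n * \<kappa> n ^ Suc c = q"
      using \<kappa> by (simp add: q_def)
    finally have qk: "(2 * L * (real n * (real n + 1)) / \<kappa> n) ^ k * \<kappa> n ^ (Suc c * k) = q ^ k" .
    \<comment> \<open>As \<open>q \<le> 1\<close> and \<open>1 \<le> k\<close>, the case of one
      component is the worst.\<close>
    have "q ^ k \<le> q ^ 1"
      using q q0 small(2) k by (intro power_decreasing) auto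
    then have "q ^ k \<le> Q / real n ^ 3"
      using q by simp
    then have "M * (real n * (real n + 1)) * q ^ k \<le> M * (2 * real n ^ 2) * (Q / real n ^ 3)"
      using M q0 by (intro mult_mono[OF mult_left_mono[OF n2]]) auto
    also have "\<dots> = 2 * M * Q / real n"
      using n by (simp add: power2_eq_square power3_eq_cube)
    finally have *: "M * (real n * (real n + 1)) * q ^ k \<le> 2 * M * Q / real n" .
    \<comment> \<open>The constant is an integer, so the threshold is \<open>real m\<close> with
      \<open>m = Suc c * k\<close>.\<close>
    have "(\<integral>\<^sup>+X. posterior_prob_clusters_gt (dp_prior (\<kappa> n) L) n X (real (Suc c * k))
        \<partial>iid_sample n (gaussian_mixture \<nu>)) \<le>
        ennreal (M * (real n * (real n + 1)) *
          (2 * L * (real n * (real n + 1)) / \<kappa> n) ^ k * \<kappa> n ^ (Suc c * k))"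
      unfolding \<nu> M_def using n \<open>1 / real n \<le> L\<close> small(1) \<kappa> w s
      by (intro expected_posterior_clusters_gt_le) auto
    also have "\<dots> \<le> ennreal (2 * M * Q / real n)"
      using *[folded qk] by (intro ennreal_leI) (simp only: mult.assoc)
    finally show "(\<integral>\<^sup>+X. posterior_prob_clusters_gt
        (dirichlet_process (\<kappa> n) (uniform_measure lborel {-L..L})) n X (real (Suc c) * real k)
        \<partial>iid_sample n (gaussian_mixture \<nu>)) \<le> ennreal (2 * M * Q / real n)"
      by (simp only: dp_prior_def of_nat_mult)
  qed
  have ev: "\<forall>\<^sub>F n in sequentially. 1 \<le> n \<and> 1 / real n \<le> L \<and> \<kappa> n \<le> 1 \<and> Q / real n ^ 3 \<le> 1"
  proof -
    have "(\<lambda>n. 1 / real n) \<longlonglongrightarrow> 0" "(\<lambda>n. Q / real n ^ 3) \<longlonglongrightarrow> 0" "(\<lambda>n. C2 * real n powr (- a0)) \<longlonglongrightarrow> 0"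
      using assms(2) by real_asymp+
    then have "\<forall>\<^sub>F n in sequentially. 1 / real n < L" "\<forall>\<^sub>F n in sequentially. Q / real n ^ 3 < 1"
      "\<forall>\<^sub>F n in sequentially. C2 * real n powr (- a0) < 1"
      using assms(1) by (auto intro: order_tendstoD)
    then show ?thesis
      using eventually_ge_at_top[of 1]
      by eventually_elim (use C2(2) in \<open>auto intro: less_imp_le order_trans\<close>)
  qed
  have "1 < real (Suc c)"
    by (simp add: c_def)
  moreover have "(\<lambda>n. SUP \<nu>\<in>mixing_distributions L (kstar n). \<integral>\<^sup>+X. posterior_prob_clusters_gt
        (dirichlet_process (\<kappa> n) (uniform_measure lborel {-L..L})) n X (real (Suc c) * real (kstar n))
        \<partial>iid_sample n (gaussian_mixture \<nu>)) \<longlonglongrightarrow> 0"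
    if "\<forall>n. 0 < kstar n" for kstar :: "nat \<Rightarrow> nat"
  proof (rule tendsto_sandwich[OF always_eventually _ tendsto_const])
    show "\<forall>\<^sub>F n in sequentially. (SUP \<nu>\<in>mixing_distributions L (kstar n). \<integral>\<^sup>+X. posterior_prob_clusters_gt
        (dirichlet_process (\<kappa> n) (uniform_measure lborel {-L..L})) n X (real (Suc c) * real (kstar n))
        \<partial>iid_sample n (gaussian_mixture \<nu>)) \<le> ennreal (2 * M * Q / real n)"
      using ev by eventually_elim (use bound that in blast)
    have "(\<lambda>n. 2 * M * Q / real n) \<longlonglongrightarrow> 0"
      by real_asymp
    then show "(\<lambda>n. ennreal (2 * M * Q / real n)) \<longlonglongrightarrow> 0"
      using tendsto_ennrealI by fastforce
  qed simp
  ultimately show ?thesis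
    by blast
qed

end
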